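(* Let $(A,\mathfrak m)$ be a Noetherian local ring with infinite residue field, let $I$ be a regular ideal of $A$ with analytic spread one and reduction number $r$, and let $J=(a)$ be a minimal reduction of $I$. Let $\alpha_i,\alpha_{i,j}$ be the non-negative integers determined by the graded decomposition of $F(I)$ as an $F(J)$-module $$F(I)\cong\bigoplus_{i=0}^r(F(J)(-i))^{\alpha_i}\oplus\bigoplus_{i=1}^{r-1}\bigoplus_{j=1}^{r-i}\left((F(J)/a^{j}F(J))(-i)\right)^{\alpha_{i,j}},$$ and put $f_{k,l}:=\lambda\big((I^k\cap(\mathfrak m I^{k+l}:a^l))/\mathfrak m I^k\big)$. Then for $1\leq k\leq r-1$ and $1\leq l\leq r-k$, $$f_{k,l}=\sum_{(i,j)\in\Lambda}\alpha_{i,j},\qquad\text{where }\Lambda:=\{(i,j)\mid 1\leq i\leq k,\ k-i+1\leq j\leq k-i+l\}.$$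
   Context: For an ideal $L$ of $A$, $F(L)=\bigoplus_{n\ge0}L^n/\mathfrak m L^n$ (with $L^0=A$) is its fiber cone; the analytic spread of $I$ is $l(I)=\dim F(I)$. An ideal is regular if it contains a non-zero-divisor of $A$. A reduction of $I$ is an ideal $J\subseteq I$ with $I^{n+1}=JI^n$ for some $n$; it is minimal if it is minimal under inclusion among reductions. When $l(I)=1$ (and the residue field is infinite) the minimal reductions of $I$ are principal; for $I$ regular of analytic spread one, the least $r$ with $I^{r+1}=JI^r$ does not depend on the minimal reduction $J$ and is called the reduction number $r$ of $I$. For a minimal reduction $J=(a)$, $F(J)\subseteq F(I)$ is a polynomial ring over $A/\mathfrak m$ in the one variable $a^0$ = class of $a$ in $I/\mathfrak m I$, and $F(I)$ is a finitely generated graded $F(J)$-module; $a^jF(J)$ means $(a^0)^jF(J)$, and $M(-i)_n=M_{n-i}$. A decomposition of the displayed form always exists by the structure theorem for graded modules, with exponents uniquely determined by $J$. $\lambda$ denotes length; colons are taken in $A$. *)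

theory Defs
  imports "HOL-Library.Extended_Nat" "HOL-Algebra.Ideal_Product" "HOL-Algebra.Ring_Divisibility"
    "HOL-Algebra.QuotRing" "HOL-Algebra.Module"
begin

(* Multiset.mult shadows the record field mult of HOL-Algebra. *)
hide_const (open) Multiset.mult

section \<open>Ideals of a local ring\<close>

definition local_ring :: "('a, 'b) ring_scheme \<Rightarrow> 'a set \<Rightarrow> bool" where
  "local_ring A \<mm> \<longleftrightarrow>
     cring A \<and> maximalideal \<mm> A \<and> (\<forall>\<nn>. maximalideal \<nn> A \<longrightarrow> \<nn> = \<mm>)"

text \<open>The unit of the monoid of ideals is the carrier, so the zeroth power is the whole ring.\<close>

abbreviation ideal_pow :: "('a, 'b) ring_scheme \<Rightarrow> 'a set \<Rightarrow> nat \<Rightarrow> 'a set" where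
  "ideal_pow A L n \<equiv> L [^]\<^bsub>ideals_set A\<^esub> n"

definition nonzerodivisor :: "('a, 'b) ring_scheme \<Rightarrow> 'a \<Rightarrow> bool" where
  "nonzerodivisor A x \<longleftrightarrow>
     x \<in> carrier A \<and> (\<forall>y \<in> carrier A. x \<otimes>\<^bsub>A\<^esub> y = \<zero>\<^bsub>A\<^esub> \<longrightarrow> y = \<zero>\<^bsub>A\<^esub>)"

definition regular_ideal :: "('a, 'b) ring_scheme \<Rightarrow> 'a set \<Rightarrow> bool" where
  "regular_ideal A L \<longleftrightarrow> ideal L A \<and> (\<exists>x \<in> L. nonzerodivisor A x)"

definition reduction :: "('a, 'b) ring_scheme \<Rightarrow> 'a set \<Rightarrow> 'a set \<Rightarrow> bool" where
  "reduction A J I \<longleftrightarrow>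
     ideal J A \<and> J \<subseteq> I \<and> (\<exists>n. ideal_pow A I (Suc n) = ideal_prod A J (ideal_pow A I n))"

definition minimal_reduction :: "('a, 'b) ring_scheme \<Rightarrow> 'a set \<Rightarrow> 'a set \<Rightarrow> bool" where
  "minimal_reduction A J I \<longleftrightarrow> reduction A J I \<and> (\<forall>J'. reduction A J' I \<and> J' \<subseteq> J \<longrightarrow> J' = J)"

definition reduction_number_wrt :: "('a, 'b) ring_scheme \<Rightarrow> 'a set \<Rightarrow> 'a set \<Rightarrow> nat" where
  "reduction_number_wrt A J I =
     (LEAST n. ideal_pow A I (Suc n) = ideal_prod A J (ideal_pow A I n))"

text \<open>
  The value common to all minimal reductions. It is meaningful when that value is independent of
  the minimal reduction, as it is for regular ideals of analytic spread one.
\<close>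

definition reduction_number :: "('a, 'b) ring_scheme \<Rightarrow> 'a set \<Rightarrow> nat" where
  "reduction_number A I =
     (THE r. \<forall>J. minimal_reduction A J I \<longrightarrow> reduction_number_wrt A J I = r)"

definition colon_elt :: "('a, 'b) ring_scheme \<Rightarrow> 'a set \<Rightarrow> 'a \<Rightarrow> 'a set" where
  "colon_elt A L y = {x \<in> carrier A. x \<otimes>\<^bsub>A\<^esub> y \<in> L}"

definition krull_dim :: "('a, 'b) ring_scheme \<Rightarrow> enat" where
  "krull_dim R =
     Sup {enat n | n. \<exists>P. (\<forall>i\<le>n. primeideal (P i) R) \<and> (\<forall>i<n. P i \<subset> P (Suc i))}"


section \<open>Quotient modules and length\<close>

text \<open>
  The module record extends the ring record, but a module uses only the fields carrier, zero, add
  and smult; the fields mult and one are left undefined below.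
\<close>

definition self_module :: "('a, 'b) ring_scheme \<Rightarrow> ('a, 'a) module" where
  "self_module A =
     \<lparr>carrier = carrier A, mult = undefined, one = undefined, zero = zero A, add = add A,
      smult = mult A\<rparr>"

definition quot_module :: "('a, 'b, 'm) module_scheme \<Rightarrow> 'b set \<Rightarrow> ('a, 'b set) module" where
  "quot_module M K =
     \<lparr>carrier = a_rcosets\<^bsub>M\<^esub> K, mult = undefined, one = undefined, zero = K, add = set_add M,
      smult = (\<lambda>s X. \<Union>x\<in>X. K +>\<^bsub>M\<^esub> (s \<odot>\<^bsub>M\<^esub> x))\<rparr>"

text \<open>For ideals \<open>K \<subseteq> L\<close> of \<open>A\<close>, the \<open>A\<close>-module \<open>L / K\<close>.\<close>

definition ideal_quot :: "('a, 'b) ring_scheme \<Rightarrow> 'a set \<Rightarrow> 'a set \<Rightarrow> ('a, 'a set) module" where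
  "ideal_quot A L K = quot_module (self_module A \<lparr>carrier := L\<rparr>) K"

definition module_length :: "('a, 'b) ring_scheme \<Rightarrow> ('a, 'c, 'm) module_scheme \<Rightarrow> enat" where
  "module_length R M =
     Sup {enat n | n. \<exists>N. (\<forall>i\<le>n. submodule (N i) R M) \<and> (\<forall>i<n. N i \<subset> N (Suc i))}"


section \<open>The fiber cone\<close>

definition fiber_piece ::
  "('a, 'b) ring_scheme \<Rightarrow> 'a set \<Rightarrow> 'a set \<Rightarrow> nat \<Rightarrow> ('a, 'a set) module" where
  "fiber_piece A \<mm> L n = ideal_quot A (ideal_pow A L n) (ideal_prod A \<mm> (ideal_pow A L n))"

text \<open>The homogeneous element of degree \<open>n\<close> given by the class of \<open>x \<in> L\<^sup>n\<close> modulo \<open>\<mm> L\<^sup>n\<close>.\<close>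

definition fiber_class ::
  "('a, 'b) ring_scheme \<Rightarrow> 'a set \<Rightarrow> 'a set \<Rightarrow> nat \<Rightarrow> 'a \<Rightarrow> (nat \<Rightarrow> 'a set)" where
  "fiber_class A \<mm> L n x =
     (\<lambda>i. if i = n then ideal_prod A \<mm> (ideal_pow A L n) +>\<^bsub>A\<^esub> x else \<zero>\<^bsub>fiber_piece A \<mm> L i\<^esub>)"

text \<open>
  An element of the fiber cone is the family of its homogeneous components. The product of the
  classes of \<open>x \<in> L\<^sup>i\<close> and \<open>y \<in> L\<^sup>j\<close> is the class of \<open>xy\<close> modulo \<open>\<mm> L\<^sup>i\<^sup>+\<^sup>j\<close>.
\<close>

definition fiber_cone ::
  "('a, 'b) ring_scheme \<Rightarrow> 'a set \<Rightarrow> 'a set \<Rightarrow> (nat \<Rightarrow> 'a set) ring" where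
  "fiber_cone A \<mm> L =
     \<lparr>carrier = {f. (\<forall>n. f n \<in> carrier (fiber_piece A \<mm> L n)) \<and>
                    finite {n. f n \<noteq> \<zero>\<^bsub>fiber_piece A \<mm> L n\<^esub>}},
      mult = (\<lambda>f g n. \<Oplus>\<^bsub>fiber_piece A \<mm> L n\<^esub> i \<in> {..n}.
                rcoset_mult A (ideal_prod A \<mm> (ideal_pow A L n)) (f i) (g (n - i))),
      one = fiber_class A \<mm> L 0 \<one>\<^bsub>A\<^esub>,
      zero = (\<lambda>n. \<zero>\<^bsub>fiber_piece A \<mm> L n\<^esub>),
      add = (\<lambda>f g n. f n \<oplus>\<^bsub>fiber_piece A \<mm> L n\<^esub> g n)\<rparr>"

definition analytic_spread :: "('a, 'b) ring_scheme \<Rightarrow> 'a set \<Rightarrow> 'a set \<Rightarrow> enat" where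
  "analytic_spread A \<mm> I = krull_dim (fiber_cone A \<mm> I)"

text \<open>
  For \<open>J \<subseteq> I\<close>, the natural map from the fiber cone of \<open>J\<close> to that of \<open>I\<close>, induced by the
  inclusions \<open>J\<^sup>n \<subseteq> I\<^sup>n\<close>.
\<close>

definition fiber_map ::
  "('a, 'b) ring_scheme \<Rightarrow> 'a set \<Rightarrow> 'a set \<Rightarrow> (nat \<Rightarrow> 'a set) \<Rightarrow> (nat \<Rightarrow> 'a set)" where
  "fiber_map A \<mm> I f = (\<lambda>n. \<Union>x \<in> f n. ideal_prod A \<mm> (ideal_pow A I n) +>\<^bsub>A\<^esub> x)"


section \<open>Graded modules\<close>

text \<open>
  All graded modules below vanish in negative degrees, so that the homogeneous components \<open>hcomp\<close>
  are indexed by natural numbers.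
\<close>

record ('a, 'b) graded_module = "('a, 'b) module" +
  hcomp :: "nat \<Rightarrow> 'b set"

definition gm_iso ::
  "('a, 'r) ring_scheme \<Rightarrow> ('a, 'b) graded_module \<Rightarrow> ('a, 'c) graded_module \<Rightarrow> bool" where
  "gm_iso R M N \<longleftrightarrow>
     (\<exists>\<phi>. bij_betw \<phi> (carrier M) (carrier N) \<and>
          (\<forall>x \<in> carrier M. \<forall>y \<in> carrier M. \<phi> (x \<oplus>\<^bsub>M\<^esub> y) = \<phi> x \<oplus>\<^bsub>N\<^esub> \<phi> y) \<and>
          (\<forall>s \<in> carrier R. \<forall>x \<in> carrier M. \<phi> (s \<odot>\<^bsub>M\<^esub> x) = s \<odot>\<^bsub>N\<^esub> \<phi> x) \<and>
          (\<forall>n. \<phi> ` hcomp M n = hcomp N n))"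

definition gm_shift :: "nat \<Rightarrow> ('a, 'b) graded_module \<Rightarrow> ('a, 'b) graded_module" where
  "gm_shift i M = M \<lparr>hcomp := (\<lambda>n. if i \<le> n then hcomp M (n - i) else {\<zero>\<^bsub>M\<^esub>})\<rparr>"

definition gm_quot :: "('a, 'b) graded_module \<Rightarrow> 'b set \<Rightarrow> ('a, 'b set) graded_module" where
  "gm_quot M K =
     module.extend (quot_module M K)
       (graded_module.fields (\<lambda>n. (\<lambda>x. K +>\<^bsub>M\<^esub> x) ` hcomp M n))"

definition gm_sum ::
  "'i set \<Rightarrow> ('i \<Rightarrow> ('a, 'b) graded_module) \<Rightarrow> ('a, 'i \<Rightarrow> 'b) graded_module" where
  "gm_sum S M =
     \<lparr>carrier = {x \<in> \<Pi>\<^sub>E i\<in>S. carrier (M i). finite {i \<in> S. x i \<noteq> \<zero>\<^bsub>M i\<^esub>}},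
      mult = undefined, one = undefined,
      zero = (\<lambda>i\<in>S. \<zero>\<^bsub>M i\<^esub>),
      add = (\<lambda>x y. \<lambda>i\<in>S. x i \<oplus>\<^bsub>M i\<^esub> y i),
      smult = (\<lambda>s x. \<lambda>i\<in>S. s \<odot>\<^bsub>M i\<^esub> x i),
      hcomp = (\<lambda>n. {x \<in> \<Pi>\<^sub>E i\<in>S. hcomp (M i) n. finite {i \<in> S. x i \<noteq> \<zero>\<^bsub>M i\<^esub>}})\<rparr>"

definition gm_pair ::
  "('a, 'b) graded_module \<Rightarrow> ('a, 'c) graded_module \<Rightarrow> ('a, 'b \<times> 'c) graded_module" where
  "gm_pair M N =
     \<lparr>carrier = carrier M \<times> carrier N, mult = undefined, one = undefined,
      zero = (\<zero>\<^bsub>M\<^esub>, \<zero>\<^bsub>N\<^esub>),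
      add = (\<lambda>x y. (fst x \<oplus>\<^bsub>M\<^esub> fst y, snd x \<oplus>\<^bsub>N\<^esub> snd y)),
      smult = (\<lambda>s x. (s \<odot>\<^bsub>M\<^esub> fst x, s \<odot>\<^bsub>N\<^esub> snd x)),
      hcomp = (\<lambda>n. hcomp M n \<times> hcomp N n)\<rparr>"

definition gm_power :: "('a, 'b) graded_module \<Rightarrow> nat \<Rightarrow> ('a, nat \<Rightarrow> 'b) graded_module" where
  "gm_power M c = gm_sum {..<c} (\<lambda>_. M)"

text \<open>
  The fiber cone of \<open>I\<close> as a graded module over the fiber cone of some \<open>J \<subseteq> I\<close>; scalars act
  through the natural map, so the definition does not mention \<open>J\<close>.
\<close>

definition fiber_module ::
  "('a, 'b) ring_scheme \<Rightarrow> 'a set \<Rightarrow> 'a set \<Rightarrow> (nat \<Rightarrow> 'a set, nat \<Rightarrow> 'a set) graded_module" where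
  "fiber_module A \<mm> I =
     \<lparr>carrier = carrier (fiber_cone A \<mm> I), mult = undefined, one = undefined,
      zero = zero (fiber_cone A \<mm> I), add = add (fiber_cone A \<mm> I),
      smult = (\<lambda>s f. fiber_map A \<mm> I s \<otimes>\<^bsub>fiber_cone A \<mm> I\<^esub> f),
      hcomp = (\<lambda>n. {f \<in> carrier (fiber_cone A \<mm> I).
                      \<forall>i. i \<noteq> n \<longrightarrow> f i = \<zero>\<^bsub>fiber_piece A \<mm> I i\<^esub>})\<rparr>"

text \<open>For \<open>J = (a)\<close>: the module \<open>F(J) / a\<^sup>j F(J)\<close>, where \<open>a\<close> acts as its class in \<open>J / \<mm> J\<close>.\<close>

definition fiber_torsion ::
  "('a, 'b) ring_scheme \<Rightarrow> 'a set \<Rightarrow> 'a set \<Rightarrow> 'a \<Rightarrow> nat \<Rightarrow>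
     (nat \<Rightarrow> 'a set, (nat \<Rightarrow> 'a set) set) graded_module" where
  "fiber_torsion A \<mm> J a j =
     gm_quot (fiber_module A \<mm> J)
       (PIdl\<^bsub>fiber_cone A \<mm> J\<^esub> (fiber_class A \<mm> J 1 a [^]\<^bsub>fiber_cone A \<mm> J\<^esub> j))"

text \<open>The number \<open>\<alpha> i\<close> counts the free and \<open>\<beta> i j\<close> the torsion summands generated in degree \<open>i\<close>.\<close>

definition decomposition_module ::
  "('a, 'b) ring_scheme \<Rightarrow> 'a set \<Rightarrow> 'a set \<Rightarrow> 'a \<Rightarrow> nat \<Rightarrow> (nat \<Rightarrow> nat) \<Rightarrow> (nat \<Rightarrow> nat \<Rightarrow> nat) \<Rightarrow>
     (nat \<Rightarrow> 'a set, (nat \<Rightarrow> nat \<Rightarrow> nat \<Rightarrow> 'a set) \<times>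
                    (nat \<Rightarrow> nat \<Rightarrow> nat \<Rightarrow> (nat \<Rightarrow> 'a set) set)) graded_module" where
  "decomposition_module A \<mm> J a r \<alpha> \<beta> =
     gm_pair
       (gm_sum {0..r} (\<lambda>i. gm_power (gm_shift i (fiber_module A \<mm> J)) (\<alpha> i)))
       (gm_sum {1..r - 1} (\<lambda>i. gm_sum {1..r - i} (\<lambda>j.
          gm_power (gm_shift i (fiber_torsion A \<mm> J a j)) (\<beta> i j))))"

definition f_length ::
  "('a, 'b) ring_scheme \<Rightarrow> 'a set \<Rightarrow> 'a set \<Rightarrow> 'a \<Rightarrow> nat \<Rightarrow> nat \<Rightarrow> enat" where
  "f_length A \<mm> I a k l =
     module_length A
       (ideal_quot A
         (ideal_pow A I k \<inter> colon_elt A (ideal_prod A \<mm> (ideal_pow A I (k + l))) (a [^]\<^bsub>A\<^esub> l))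
         (ideal_prod A \<mm> (ideal_pow A I k)))"

end

theory Submission
  imports Defs
begin

text \<open>
  The space measured by \<open>f\<^sub>k\<^sub>,\<^sub>l\<close> is the kernel of multiplication by \<open>a\<^sup>l\<close> on the degree \<open>k\<close>
  component of \<open>F(I)\<close>, so it can be computed in the decomposition. Since \<open>I\<close> is regular and
  some power of each of its elements lies in \<open>(a)\<close>, the element \<open>a\<close> is a non-zero-divisor; hence
  \<open>F(J)\<close> is one-dimensional over \<open>A/\<mm>\<close> in each degree and multiplication by \<open>a\<close> is injective
  on it. Free summands therefore contribute nothing. The summand \<open>(F(J)/a\<^sup>jF(J))(-i)\<close> is
  one-dimensional in the degrees from \<open>i\<close> to \<open>i + j - 1\<close> and zero in all others, so it meets the
  kernel exactly when \<open>i \<le> k\<close> and \<open>k - i < j \<le> k - i + l\<close>.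
\<close>

section \<open>Quotients of ideals and their length\<close>

text \<open>Length is a supremum over chains of submodules, so a dimension count must become a
  statement about chains. \<open>module_length_coordinates\<close> does this for coordinate
  functions with values in the ring itself that are linear only modulo \<open>\<mm>\<close>. The
  decomposition supplies such functions: every homogeneous element of F(J) is the class of some
  \<open>c \<otimes> a [^] n\<close>, and since powers of a cancel, the residue of c modulo
  \<open>\<mm>\<close> is determined by that class. In degrees below j this survives in
  F(J)/a^jF(J), so each relevant torsion summand yields one coordinate, a chosen c. The choice is
  free modulo \<open>\<mm>\<close>, which is why linearity is stated as equality of cosets. A second
  gap: the isomorphism is linear over F(J), whereas length is taken over A. A scalar b of A is
  therefore turned into the degree 0 class of b, and multiplication by a^l into the scalar given by
  the degree l class of a^l.\<close>

lemma (in ideal) rcos_smult_UN: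
  assumes c: "c \<in> carrier R" and x: "x \<in> carrier R"
  shows "(\<Union>y \<in> I +> x. I +> (c \<otimes> y)) = I +> (c \<otimes> x)"
proof -
  have "I +> (c \<otimes> y) = I +> (c \<otimes> x)" if y: "y \<in> I +> x" for y
  proof -
    obtain h where h: "h \<in> I" "y = h \<oplus> x"
      using y by (auto simp: a_r_coset_def')
    hence "c \<otimes> y = c \<otimes> h \<oplus> c \<otimes> x"
      using assms Icarr[OF h(1)] by (simp add: r_distr)
    hence "c \<otimes> y \<in> I +> (c \<otimes> x)"
      using I_l_closed[OF h(1) c] by (auto simp: a_r_coset_def')
    thus ?thesis
      by (rule a_repr_independence'[symmetric]) (use assms in auto)
  qed
  thus ?thesis by (intro UN_constant_eq[OF a_rcos_self[OF x]] ballI)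
qed

lemma carrier_ideal_quot: "carrier (ideal_quot R L K) = (\<lambda>x. K +>\<^bsub>R\<^esub> x) ` L"
  by (auto simp: ideal_quot_def quot_module_def self_module_def A_RCOSETS_def RCOSETS_def
      a_r_coset_def r_coset_def)

lemma zero_ideal_quot: "\<zero>\<^bsub>ideal_quot R L K\<^esub> = K"
  by (simp add: ideal_quot_def quot_module_def)

context cring
begin

lemma rcos_eq_self_iff:
  assumes "ideal K R" "x \<in> carrier R"
  shows "K +> x = K \<longleftrightarrow> x \<in> K"
  using assms by (meson a_coset_join1 a_coset_join2 ideal.axioms(1) additive_subgroup.a_subgroup)

lemma add_ideal_quot:
  assumes "ideal K R" "x \<in> carrier R" "y \<in> carrier R"
  shows "(K +> x) \<oplus>\<^bsub>ideal_quot R L K\<^esub> (K +> y) = K +> (x \<oplus> y)"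
  using ideal.a_rcos_sum[OF assms]
  by (simp add: ideal_quot_def quot_module_def self_module_def set_add_def set_mult_def)

lemma smult_ideal_quot:
  assumes "ideal K R" "c \<in> carrier R" "x \<in> carrier R"
  shows "c \<odot>\<^bsub>ideal_quot R L K\<^esub> (K +> x) = K +> (c \<otimes> x)"
  using ideal.rcos_smult_UN[OF assms]
  by (simp add: ideal_quot_def quot_module_def self_module_def a_r_coset_def r_coset_def)

lemma module_ideal_quot:
  assumes K: "ideal K R" and L: "ideal L R" and "K \<subseteq> L"
  shows "module R (ideal_quot R L K)"
proof -
  interpret K: ideal K R by (fact K)
  interpret L: ideal L R by (fact L)
  note simps = carrier_ideal_quot add_ideal_quot[OF K] smult_ideal_quot[OF K]
  have zero: "\<zero>\<^bsub>ideal_quot R L K\<^esub> = K +> \<zero>"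
    using rcos_eq_self_iff[OF K, of \<zero>] by (simp add: zero_ideal_quot)
  have neg: "\<exists>y\<in>L. K +> (y \<oplus> x) = K +> \<zero>" if "x \<in> L" for x
    using that by (intro bexI[of _ "\<ominus> x"]) (auto simp: l_neg L.Icarr)
  show ?thesis
  proof (rule moduleI)
    show "abelian_group (ideal_quot R L K)"
    proof (rule abelian_groupI)
      fix X Y assume "X \<in> carrier (ideal_quot R L K)" "Y \<in> carrier (ideal_quot R L K)"
      thus "X \<oplus>\<^bsub>ideal_quot R L K\<^esub> Y = Y \<oplus>\<^bsub>ideal_quot R L K\<^esub> X"
        by (auto simp: simps L.Icarr a_comm)
    next
      fix X assume "X \<in> carrier (ideal_quot R L K)"
      thus "\<exists>Y\<in>carrier (ideal_quot R L K). Y \<oplus>\<^bsub>ideal_quot R L K\<^esub> X = \<zero>\<^bsub>ideal_quot R L K\<^esub>"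
        using neg by (auto simp: simps zero L.Icarr)
    qed (auto simp: simps zero a_assoc L.Icarr)
  qed (auto simp: simps is_cring L.Icarr L.I_l_closed l_distr r_distr m_assoc)
qed

end

section \<open>Length of a quotient from coordinates modulo a maximal ideal\<close>

text \<open>Outside \<open>\<mm>\<close> an element is a unit modulo \<open>\<mm>\<close>, because
  \<open>\<mm>\<close> and u together generate the ring. This is the elimination step that clears a
  coordinate x with a pivot u.\<close>

lemma (in cring) maximalideal_solve:
  assumes "maximalideal \<mm> R" and u: "u \<in> carrier R" "u \<notin> \<mm>" and x: "x \<in> carrier R"
  shows "\<exists>c \<in> carrier R. c \<otimes> u \<oplus> x \<in> \<mm>"
proof -
  interpret m: maximalideal \<mm> R by fact
  interpret U: ideal "PIdl u" R by (rule cgenideal_ideal[OF u(1)])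
  have id: "ideal (\<mm> <+>\<^bsub>R\<^esub> PIdl u) R"
    by (intro add_ideals m.ideal_axioms U.ideal_axioms)
  have mem: "z \<in> \<mm> <+>\<^bsub>R\<^esub> PIdl u \<longleftrightarrow> (\<exists>h\<in>\<mm>. \<exists>k\<in>PIdl u. z = h \<oplus> k)" for z
    by (simp add: set_add_def')
  have "\<mm> \<subseteq> \<mm> <+>\<^bsub>R\<^esub> PIdl u"
  proof
    fix h assume h: "h \<in> \<mm>"
    show "h \<in> \<mm> <+>\<^bsub>R\<^esub> PIdl u"
      unfolding mem by (rule bexI[OF bexI[OF _ U.zero_closed] h]) (simp add: m.Icarr[OF h])
  qed
  moreover have "u \<in> \<mm> <+>\<^bsub>R\<^esub> PIdl u"
    unfolding mem
    by (rule bexI[OF bexI[OF _ cgenideal_self[OF u(1)]] m.zero_closed]) (simp add: u(1))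
  moreover have "\<mm> <+>\<^bsub>R\<^esub> PIdl u \<subseteq> carrier R"
    using ideal.Icarr[OF id] by (rule subsetI)
  ultimately have "\<mm> <+>\<^bsub>R\<^esub> PIdl u = carrier R"
    using m.I_maximal[OF id] u(2) by blast
  hence "\<one> \<in> \<mm> <+>\<^bsub>R\<^esub> PIdl u" by (simp only: one_closed)
  then obtain h k where h: "h \<in> \<mm>" and k: "k \<in> PIdl u" and hk: "\<one> = h \<oplus> k"
    unfolding mem by (elim bexE)
  obtain d where d: "d \<in> carrier R" and "k = d \<otimes> u"
    using k unfolding cgenideal_def by (elim CollectE exE conjE)
  hence one: "h \<oplus> d \<otimes> u = \<one>" by (simp only: hk)
  have hc: "h \<in> carrier R" by (rule m.Icarr[OF h])
  \<comment> \<open>Multiplying 1 = h + du by x gives x - (dx)u = xh, which lies in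
    \<open>\<mm>\<close>; so the witness is c = -dx.\<close>
  have "\<ominus> (d \<otimes> x) \<otimes> u \<oplus> (h \<oplus> d \<otimes> u) \<otimes> x = x \<otimes> h"
    using d hc u(1) x by algebra
  hence "\<ominus> (d \<otimes> x) \<otimes> u \<oplus> x = x \<otimes> h"
    by (simp add: one x)
  thus ?thesis
    using d x m.I_l_closed[OF h x] by (intro bexI[of _ "\<ominus> (d \<otimes> x)"]) auto
qed

lemma finite_strict_chain_card:
  fixes n :: nat
  assumes "\<And>i. i \<le> n \<Longrightarrow> finite (D i)" "\<And>i. i < n \<Longrightarrow> D i \<subset> D (Suc i)"
  shows "n \<le> card (D n)"
  using assms
proof (induction n)
  case (Suc n)
  have "n \<le> card (D n)" using Suc by auto
  also have "\<dots> < card (D (Suc n))" using Suc.prems by (intro psubset_card_mono) auto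
  finally show ?case by simp
qed simp

text \<open>
  The set of pivots of a submodule \<open>S\<close>, i.e. the positions of the last coordinate outside
  \<open>\<mm>\<close> of its elements, strictly increases with \<open>S\<close>.
\<close>

lemma (in cring) module_length_coordinates:
  fixes p :: "nat \<Rightarrow> 'a \<Rightarrow> 'a"
  assumes max: "maximalideal \<mm> R" and K: "ideal K R" and L: "ideal L R" and KL: "K \<subseteq> L"
    and closed: "\<And>s x. \<lbrakk>s < N; x \<in> L\<rbrakk> \<Longrightarrow> p s x \<in> carrier R"
    and add: "\<And>s x y. \<lbrakk>s < N; x \<in> L; y \<in> L\<rbrakk> \<Longrightarrow> \<mm> +> p s (x \<oplus> y) = \<mm> +> (p s x \<oplus> p s y)"
    and smult: "\<And>s c x. \<lbrakk>s < N; c \<in> carrier R; x \<in> L\<rbrakk> \<Longrightarrow> \<mm> +> p s (c \<otimes> x) = \<mm> +> (c \<otimes> p s x)"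
    and ker: "\<And>x. x \<in> L \<Longrightarrow> x \<in> K \<longleftrightarrow> (\<forall>s<N. p s x \<in> \<mm>)"
    and basis: "\<And>s. s < N \<Longrightarrow> \<exists>x\<in>L. p s x \<notin> \<mm> \<and> (\<forall>t<N. t \<noteq> s \<longrightarrow> p t x \<in> \<mm>)"
  shows "module_length R (ideal_quot R L K) = enat N"
proof -
  interpret m: maximalideal \<mm> R by (fact max)
  interpret K: ideal K R by (fact K)
  interpret L: ideal L R by (fact L)
  interpret Q: module R "ideal_quot R L K" by (rule module_ideal_quot) fact+
  note carr = carrier_ideal_quot[of R L K]
  note eq_iff = quotient_eq_iff_same_a_r_cos[OF K]
  have mem_m_cong: "x \<in> \<mm> \<longleftrightarrow> y \<in> \<mm>" if "\<mm> +> x = \<mm> +> y" "x \<in> carrier R" "y \<in> carrier R" for x y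
    using that rcos_eq_self_iff[OF m.ideal_axioms] by metis
  have p_add: "p s (x \<oplus> y) \<in> \<mm> \<longleftrightarrow> p s x \<oplus> p s y \<in> \<mm>" if "s < N" "x \<in> L" "y \<in> L" for s x y
    using that add closed by (intro mem_m_cong) auto
  have p_smult: "p s (c \<otimes> x) \<in> \<mm> \<longleftrightarrow> c \<otimes> p s x \<in> \<mm>" if "s < N" "c \<in> carrier R" "x \<in> L" for s c x
    using that smult closed by (intro mem_m_cong) (auto simp: L.I_l_closed)
  have p_smult_m: "p s (c \<otimes> x) \<in> \<mm>" if "s < N" "c \<in> carrier R" "x \<in> L" "p s x \<in> \<mm>" for s c x
    using that p_smult by (simp add: m.I_l_closed)
  have p_add_m: "p s (x \<oplus> y) \<in> \<mm>" if "s < N" "x \<in> L" "y \<in> L" "p s x \<in> \<mm>" "p s y \<in> \<mm>" for s x y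
    using that p_add by simp
  define D where "D S = {s. s < N \<and> (\<exists>x\<in>L. K +> x \<in> S \<and> p s x \<notin> \<mm> \<and> (\<forall>t<N. t > s \<longrightarrow> p t x \<in> \<mm>))}" for S
  have D_strict: "D S \<subset> D T"
    if S: "submodule S R (ideal_quot R L K)" and T: "submodule T R (ideal_quot R L K)" and ST: "S \<subset> T" for S T
  proof -
    have "D S \<subseteq> D T" using ST by (auto simp: D_def)
    moreover have "D S \<noteq> D T"
    proof
      assume eq: "D S = D T"
      \<comment> \<open>Gaussian elimination: with equal pivot sets, an element of T whose
        coordinates from n on lie in \<open>\<mm>\<close> is already in S. At n = 0 the element is
        the zero coset; at n = N the condition is vacuous, which gives T \<subseteq> S.\<close>
      have step: "K +> x \<in> S" if "x \<in> L" "K +> x \<in> T" "n \<le> N" "\<forall>t<N. n \<le> t \<longrightarrow> p t x \<in> \<mm>" for n x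
        using that
      proof (induction n arbitrary: x)
        case 0
        hence "x \<in> K" using ker by simp
        hence "K +> x = \<zero>\<^bsub>ideal_quot R L K\<^esub>"
          using K.Icarr by (simp add: zero_ideal_quot rcos_eq_self_iff[OF K])
        thus ?case using subgroup.one_closed[OF submodule.axioms(1)[OF S]] by simp
      next
        case (Suc n)
        have n: "n < N" using Suc.prems by simp
        show ?case
        proof (cases "p n x \<in> \<mm>")
          case True
          have "\<forall>t<N. n \<le> t \<longrightarrow> p t x \<in> \<mm>"
            using True Suc.prems(4) by (metis le_eq_less_or_eq Suc_leI)
          with Suc.prems show ?thesis by (intro Suc.IH) auto
        next
          case False
          hence "n \<in> D T" using Suc.prems n by (auto simp: D_def Suc_le_eq)
          hence "n \<in> D S" by (simp only: eq)
          then obtain u where u: "u \<in> L" "K +> u \<in> S" "p n u \<notin> \<mm>" "\<forall>t<N. t > n \<longrightarrow> p t u \<in> \<mm>"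
            by (auto simp: D_def)
          have uc: "p n u \<in> carrier R" and xc: "p n x \<in> carrier R" using closed n u Suc.prems by auto
          obtain c where c: "c \<in> carrier R" "c \<otimes> p n u \<oplus> p n x \<in> \<mm>"
            using maximalideal_solve[OF max uc u(3) xc] by blast
          \<comment> \<open>The scalar c was chosen so that coordinate n of y falls into
            \<open>\<mm>\<close>; the later coordinates stay there because those of u and x do. So
            the induction hypothesis applies to y.\<close>
          define y where "y = c \<otimes> u \<oplus> x"
          have yL: "c \<otimes> u \<in> L" "y \<in> L" using u c Suc.prems by (auto simp: y_def L.I_l_closed)
          have cuS: "K +> (c \<otimes> u) \<in> S"
            using submodule.smult_closed[OF S c(1) u(2)] smult_ideal_quot[OF K c(1)] u(1) by simp
          have yT: "K +> y \<in> T"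
            using subgroup.m_closed[OF submodule.axioms(1)[OF T], of "K +> (c \<otimes> u)" "K +> x"]
              cuS ST Suc.prems add_ideal_quot[OF K, of "c \<otimes> u" x] yL by (auto simp: y_def)
          have pcu: "p n (c \<otimes> u) \<in> carrier R" and cpu: "c \<otimes> p n u \<in> carrier R"
            using closed[OF n yL(1)] c(1) uc by (simp_all only: m_closed)
          \<comment> \<open>The coordinate of a multiple is known only modulo \<open>\<mm>\<close>,
            so it is exchanged inside a sum of cosets.\<close>
          have "\<mm> +> (p n (c \<otimes> u) \<oplus> p n x) = (\<mm> +> p n (c \<otimes> u)) <+>\<^bsub>R\<^esub> (\<mm> +> p n x)"
            by (rule m.a_rcos_sum[OF pcu xc, symmetric])
          also have "\<dots> = \<mm> +> (c \<otimes> p n u \<oplus> p n x)"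
            unfolding smult[OF n c(1) u(1)] by (rule m.a_rcos_sum[OF cpu xc])
          finally have "p n (c \<otimes> u) \<oplus> p n x \<in> \<mm>"
            using mem_m_cong[OF _ a_closed[OF pcu xc] a_closed[OF cpu xc]] c(2) by simp
          hence pny: "p n y \<in> \<mm>"
            unfolding y_def using p_add[OF n yL(1) Suc.prems(1)] by simp
          have "p t y \<in> \<mm>" if "t < N" "n \<le> t" for t
          proof (cases "t = n")
            case False
            hence "p t u \<in> \<mm>" "p t x \<in> \<mm>" using that u(4) Suc.prems(4) by simp_all
            thus ?thesis
              unfolding y_def using that(1) c(1) u(1) yL(1) Suc.prems(1)
              by (simp only: p_add_m p_smult_m)
          qed (simp add: pny)
          hence yS: "K +> y \<in> S" using yT yL Suc.prems n by (intro Suc.IH) auto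
          \<comment> \<open>Undoing the elimination: both y and the multiple of u have cosets in S,
            hence so does x.\<close>
          have "x = (\<ominus> \<one>) \<otimes> (c \<otimes> u) \<oplus> y"
            unfolding y_def using L.Icarr[OF u(1)] L.Icarr[OF Suc.prems(1)] c(1) by algebra
          moreover have "K +> ((\<ominus> \<one>) \<otimes> (c \<otimes> u)) \<in> S"
            using submodule.smult_closed[OF S _ cuS, of "\<ominus> \<one>"]
              smult_ideal_quot[OF K, of "\<ominus> \<one>" "c \<otimes> u"] L.Icarr[OF yL(1)] by simp
          ultimately show ?thesis
            using subgroup.m_closed[OF submodule.axioms(1)[OF S] _ yS]
              add_ideal_quot[OF K _ L.Icarr[OF yL(2)]] L.Icarr[OF yL(1)]
            by (metis a_inv_closed m_closed one_closed monoid.select_convs(1))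
        qed
      qed
      have "T \<subseteq> S"
      proof
        fix X assume X: "X \<in> T"
        hence "X \<in> carrier (ideal_quot R L K)"
          using subgroup.subset[OF submodule.axioms(1)[OF T]] by auto
        then obtain x where "x \<in> L" "X = K +> x" by (auto simp: carr)
        thus "X \<in> S" using step[of x N] X by auto
      qed
      thus False using ST by blast
    qed
    ultimately show ?thesis by blast
  qed
  have upper: "n \<le> N" if "\<forall>i\<le>n. submodule (M i) R (ideal_quot R L K)" "\<forall>i<n. M i \<subset> M (Suc i)" for n M
  proof -
    have "n \<le> card (D (M n))"
      using that D_strict by (intro finite_strict_chain_card) (auto simp: D_def)
    also have "\<dots> \<le> card {..<N}" by (intro card_mono) (auto simp: D_def)
    finally show ?thesis by simp
  qed
  \<comment> \<open>A flag attaining the upper bound: the dual basis vector for coordinate s lies in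
    \<open>M (Suc s)\<close> but not in \<open>M s\<close>.\<close>
  define M where "M n = (\<lambda>x. K +> x) ` {x \<in> L. \<forall>t<N. n \<le> t \<longrightarrow> p t x \<in> \<mm>}" for n
  have M_sub: "submodule (M n) R (ideal_quot R L K)" for n
  proof (rule Q.submoduleI)
    show "M n \<subseteq> carrier (ideal_quot R L K)" by (auto simp: M_def carr)
    have "\<forall>t<N. p t \<zero> \<in> \<mm>" using ker[OF subsetD[OF KL K.zero_closed]] by simp
    moreover have "K = K +> \<zero>" using rcos_eq_self_iff[OF K, of \<zero>] by simp
    ultimately show "\<zero>\<^bsub>ideal_quot R L K\<^esub> \<in> M n"
      unfolding M_def zero_ideal_quot by auto
    have sm: "c \<odot>\<^bsub>ideal_quot R L K\<^esub> X \<in> M n" if "c \<in> carrier R" "X \<in> M n" for c X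
      using that by (auto simp: M_def smult_ideal_quot[OF K] L.I_l_closed p_smult_m)
    show "c \<odot>\<^bsub>ideal_quot R L K\<^esub> X \<in> M n" if "c \<in> carrier R" "X \<in> M n" for c X
      by (rule sm[OF that])
    show "X \<oplus>\<^bsub>ideal_quot R L K\<^esub> Y \<in> M n" if "X \<in> M n" "Y \<in> M n" for X Y
      using that by (auto simp: M_def add_ideal_quot[OF K] p_add_m)
    show "\<ominus>\<^bsub>ideal_quot R L K\<^esub> X \<in> M n" if "X \<in> M n" for X
    proof -
      have "X \<in> carrier (ideal_quot R L K)" using that by (auto simp: M_def carr)
      hence "\<ominus>\<^bsub>ideal_quot R L K\<^esub> X = (\<ominus> \<one>) \<odot>\<^bsub>ideal_quot R L K\<^esub> X"
        using Q.smult_l_minus[of \<one> X] by simp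
      thus ?thesis using sm[of "\<ominus> \<one>" X] that by simp
    qed
  qed
  have M_strict: "M s \<subset> M (Suc s)" if s: "s < N" for s
  proof -
    obtain x where x: "x \<in> L" "p s x \<notin> \<mm>" "\<forall>t<N. t \<noteq> s \<longrightarrow> p t x \<in> \<mm>"
      using basis[OF s] by blast
    have "K +> x \<in> M (Suc s)" using x by (auto simp: M_def)
    moreover have "K +> x \<notin> M s"
    proof
      assume "K +> x \<in> M s"
      then obtain y where y: "y \<in> L" "p s y \<in> \<mm>" "K +> x = K +> y" using s by (auto simp: M_def)
      \<comment> \<open>Another representative of the same coset differs by an element of K, whose
        coordinates all lie in \<open>\<mm>\<close>; so coordinate s cannot change from outside
        \<open>\<mm>\<close> to inside.\<close>
      have xy: "x \<ominus> y \<in> K" using y x eq_iff by auto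
      hence "p s (x \<ominus> y) \<in> \<mm>" using ker KL s by blast
      moreover have "x = (x \<ominus> y) \<oplus> y" using L.Icarr x y by algebra
      ultimately have "p s x \<in> \<mm>" using p_add_m[OF s, of "x \<ominus> y" y] xy KL y by auto
      thus False using x by simp
    qed
    moreover have "M s \<subseteq> M (Suc s)" by (auto simp: M_def)
    ultimately show ?thesis by blast
  qed
  show ?thesis
    unfolding module_length_def
  proof (rule antisym)
    show "Sup {enat n |n. \<exists>M. (\<forall>i\<le>n. submodule (M i) R (ideal_quot R L K)) \<and> (\<forall>i<n. M i \<subset> M (Suc i))} \<le> enat N"
      using upper by (intro Sup_least) auto
    show "enat N \<le> Sup {enat n |n. \<exists>M. (\<forall>i\<le>n. submodule (M i) R (ideal_quot R L K)) \<and> (\<forall>i<n. M i \<subset> M (Suc i))}"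
      using M_sub M_strict by (intro Sup_upper) blast
  qed
qed

section \<open>The fiber cone\<close>

locale fiber = cring R for R (structure) +
  fixes \<mm> L :: "'a set"
  assumes m_ideal: "ideal \<mm> R" and L_ideal: "ideal L R"
begin

abbreviation P :: "nat \<Rightarrow> 'a set" where "P n \<equiv> ideal_pow R L n"
abbreviation K :: "nat \<Rightarrow> 'a set" where "K n \<equiv> ideal_prod R \<mm> (P n)"
abbreviation F :: "(nat \<Rightarrow> 'a set) ring" where "F \<equiv> fiber_cone R \<mm> L"
abbreviation cls :: "nat \<Rightarrow> 'a \<Rightarrow> nat \<Rightarrow> 'a set" where "cls \<equiv> fiber_class R \<mm> L"

lemma P_0: "P 0 = carrier R"
  by (simp add: ideals_set_def)

lemma P_ideal: "ideal (P n) R"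
proof (induction n)
  case 0
  show ?case by (simp only: P_0 oneideal)
next
  case (Suc n)
  have "P (Suc n) = ideal_prod R (P n) L" by (simp add: ideals_set_def)
  thus ?case using ideal_prod_is_ideal[OF Suc L_ideal] by (simp only:)
qed

lemma K_ideal: "ideal (K n) R"
  by (rule ideal_prod_is_ideal[OF m_ideal P_ideal])

lemma K_subset_P: "K n \<subseteq> P n"
  using ideal_prod_inter[OF m_ideal P_ideal[of n]] by (rule subset_trans) (rule Int_lower2)

lemma P_carrier: "x \<in> P n \<Longrightarrow> x \<in> carrier R"
  by (rule ideal.Icarr[OF P_ideal])

lemma zero_in_K: "\<zero> \<in> K n"
  by (rule additive_subgroup.zero_closed[OF ideal.axioms(1)[OF K_ideal]])

lemma zero_in_P: "\<zero> \<in> P n"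
  by (rule additive_subgroup.zero_closed[OF ideal.axioms(1)[OF P_ideal]])

lemma K_rcos_zero: "K n +> \<zero> = K n"
  using rcos_eq_self_iff[OF K_ideal, of \<zero> n] zero_in_K[of n] by (simp only: zero_closed)

lemma P_add: "P (i + j) = ideal_prod R (P i) (P j)"
proof -
  interpret IS: comm_monoid "ideals_set R" by (rule ideals_set_is_comm_monoid)
  have "P i \<otimes>\<^bsub>ideals_set R\<^esub> P j = P (i + j)"
    by (rule IS.nat_pow_mult) (simp add: ideals_set_def L_ideal)
  thus ?thesis by (simp add: ideals_set_def)
qed

lemma P_mult_closed: "\<lbrakk>x \<in> P i; y \<in> P j\<rbrakk> \<Longrightarrow> x \<otimes> y \<in> P (i + j)"
  unfolding P_add by (rule ideal_prod.prod)

lemma K_mult_closed: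
  assumes "x \<in> K i" "y \<in> P j"
  shows "x \<otimes> y \<in> K (i + j)" "y \<otimes> x \<in> K (i + j)"
proof -
  show "x \<otimes> y \<in> K (i + j)"
    unfolding P_add ideal_prod_assoc[OF m_ideal P_ideal P_ideal, symmetric]
    using assms by (rule ideal_prod.prod)
  thus "y \<otimes> x \<in> K (i + j)"
    using m_comm[of x y] ideal.Icarr[OF K_ideal assms(1)] P_carrier[OF assms(2)] by simp
qed

lemma carrier_piece: "carrier (fiber_piece R \<mm> L n) = (\<lambda>x. K n +> x) ` P n"
  by (simp add: fiber_piece_def carrier_ideal_quot)

lemma zero_piece: "\<zero>\<^bsub>fiber_piece R \<mm> L n\<^esub> = K n"
  by (simp add: fiber_piece_def zero_ideal_quot)

lemma add_piece:
  assumes "x \<in> P n" "y \<in> P n"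
  shows "(K n +> x) \<oplus>\<^bsub>fiber_piece R \<mm> L n\<^esub> (K n +> y) = K n +> (x \<oplus> y)"
  unfolding fiber_piece_def by (rule add_ideal_quot[OF K_ideal P_carrier P_carrier]) fact+

lemma abelian_group_piece: "abelian_group (fiber_piece R \<mm> L n)"
  unfolding fiber_piece_def
  by (rule module.axioms(2)[OF module_ideal_quot[OF K_ideal P_ideal K_subset_P]])

lemma class_apply:
  "cls n x i = (if i = n then K n +> x else K i)"
  by (simp add: fiber_class_def zero_piece)

lemma carrier_coneD:
  assumes "f \<in> carrier F"
  obtains x where "x \<in> P n" "f n = K n +> x"
  using assms by (auto simp: fiber_cone_def carrier_piece)

lemma class_closed:
  assumes "x \<in> P n"
  shows "cls n x \<in> carrier F"
proof -
  have "cls n x i \<in> carrier (fiber_piece R \<mm> L i)" for i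
    using assms zero_in_P[of i] K_rcos_zero[of i] unfolding carrier_piece class_apply by auto
  moreover have "finite {i. cls n x i \<noteq> K i}"
    by (rule finite_subset[of _ "{n}"]) (auto simp: class_apply)
  ultimately show ?thesis by (simp add: fiber_cone_def zero_piece)
qed

lemma class_eq_zero_iff:
  assumes "x \<in> P n"
  shows "cls n x = \<zero>\<^bsub>F\<^esub> \<longleftrightarrow> x \<in> K n"
proof -
  have "cls n x = \<zero>\<^bsub>F\<^esub> \<longleftrightarrow> K n +> x = K n"
    by (auto simp: fiber_cone_def zero_piece class_apply fun_eq_iff)
  thus ?thesis using rcos_eq_self_iff[OF K_ideal P_carrier[OF assms]] by simp
qed

lemma class_eq_iff:
  assumes "x \<in> P n" "y \<in> P n"
  shows "cls n x = cls n y \<longleftrightarrow> x \<ominus> y \<in> K n"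
proof -
  have "cls n x = cls n y \<longleftrightarrow> K n +> x = K n +> y"
    by (auto simp: class_apply fun_eq_iff)
  thus ?thesis
    using quotient_eq_iff_same_a_r_cos[OF K_ideal P_carrier[OF assms(1)] P_carrier[OF assms(2)]] by simp
qed

lemma class_add:
  assumes "x \<in> P n" "y \<in> P n"
  shows "cls n x \<oplus>\<^bsub>F\<^esub> cls n y = cls n (x \<oplus> y)"
proof
  fix i
  show "(cls n x \<oplus>\<^bsub>F\<^esub> cls n y) i = cls n (x \<oplus> y) i"
    using add_piece[OF assms] add_piece[OF zero_in_P[of i] zero_in_P[of i]] K_rcos_zero[of i]
    by (auto simp: fiber_cone_def class_apply)
qed

section \<open>Products of homogeneous classes in the fiber cone\<close>

text \<open>Here \<open>rcoset_mult\<close> is applied to cosets of two different ideals and lands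
  in cosets of a third. Its union still collapses to one coset, since (h + x)(k + y) - xy = (h + x)k
  + hy lies in \<open>K (i + j)\<close> for h in \<open>K i\<close> and k in
  \<open>K j\<close>.\<close>

lemma rcoset_mult_piece:
  assumes x: "x \<in> P i" and y: "y \<in> P j"
  shows "rcoset_mult R (K (i + j)) (K i +> x) (K j +> y) = K (i + j) +> (x \<otimes> y)"
proof -
  have xc: "x \<in> carrier R" and yc: "y \<in> carrier R" using x y P_carrier by auto
  have eq: "K (i + j) +> (u \<otimes> v) = K (i + j) +> (x \<otimes> y)"
    if "u \<in> K i +> x" "v \<in> K j +> y" for u v
  proof -
    from that(1) have "\<exists>h\<in>K i. u = h \<oplus> x" by (simp add: a_r_coset_def')
    then obtain h where h: "h \<in> K i" "u = h \<oplus> x" by (elim bexE)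
    from that(2) have "\<exists>k\<in>K j. v = k \<oplus> y" by (simp add: a_r_coset_def')
    then obtain k where k: "k \<in> K j" "v = k \<oplus> y" by (elim bexE)
    have hc: "h \<in> carrier R" and kc: "k \<in> carrier R"
      using ideal.Icarr[OF K_ideal] h(1) k(1) by auto
    have hP: "h \<oplus> x \<in> P i"
      using K_subset_P h(1) x additive_subgroup.a_closed[OF ideal.axioms(1)[OF P_ideal]] by blast
    have "(h \<oplus> x) \<otimes> (k \<oplus> y) \<ominus> x \<otimes> y = (h \<oplus> x) \<otimes> k \<oplus> h \<otimes> y"
      using hc kc xc yc by algebra
    moreover have "(h \<oplus> x) \<otimes> k \<oplus> h \<otimes> y \<in> K (i + j)"
      using additive_subgroup.a_closed[OF ideal.axioms(1)[OF K_ideal]]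
        K_mult_closed(1)[OF h(1) y] K_mult_closed(2)[OF k(1) hP] by (simp only: add.commute)
    ultimately have "u \<otimes> v \<ominus> x \<otimes> y \<in> K (i + j)" by (simp only: h(2) k(2))
    thus ?thesis
      using quotient_eq_iff_same_a_r_cos[OF K_ideal, of "u \<otimes> v" "x \<otimes> y"] hc kc xc yc h(2) k(2)
      by simp
  qed
  have "x \<in> K i +> x" "y \<in> K j +> y"
    using abelian_subgroup.a_rcos_self[OF abelian_subgroupI3[OF ideal.axioms(1)[OF K_ideal] abelian_group_axioms]]
      xc yc by auto
  thus ?thesis using eq unfolding rcoset_mult_def by blast
qed

lemma rcoset_mult_zero:
  assumes "f \<in> carrier F" "g \<in> carrier F" "i \<le> n" "f i = K i \<or> g (n - i) = K (n - i)"
  shows "rcoset_mult R (K n) (f i) (g (n - i)) = K n"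
proof -
  obtain x y where x: "x \<in> P i" "f i = K i +> x" and y: "y \<in> P (n - i)" "g (n - i) = K (n - i) +> y"
    using carrier_coneD[OF assms(1), of i] carrier_coneD[OF assms(2), of "n - i"] by metis
  have n: "i + (n - i) = n" "(n - i) + i = n" using assms(3) by simp_all
  have "rcoset_mult R (K n) (f i) (g (n - i)) = K n +> (x \<otimes> y)"
    using rcoset_mult_piece[OF x(1) y(1)] unfolding n(1) x(2) y(2) .
  moreover have "x \<otimes> y \<in> K n"
  proof -
    have "x \<in> K i \<or> y \<in> K (n - i)"
      using assms(4) rcos_eq_self_iff[OF K_ideal P_carrier] x y by metis
    thus ?thesis
      using K_mult_closed(1)[OF _ y(1), of x i] K_mult_closed(2)[OF _ x(1), of y "n - i"]
        n by metis
  qed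
  ultimately show ?thesis
    using rcos_eq_self_iff[OF K_ideal] ideal.Icarr[OF K_ideal] by metis
qed

lemma mult_zeroI:
  assumes "f \<in> carrier F" "g \<in> carrier F"
    and "\<And>i. i \<le> n \<Longrightarrow> f i = K i \<or> g (n - i) = K (n - i)"
  shows "(f \<otimes>\<^bsub>F\<^esub> g) n = K n"
proof -
  interpret G: abelian_group "fiber_piece R \<mm> L n" by (rule abelian_group_piece)
  have "(f \<otimes>\<^bsub>F\<^esub> g) n =
      (\<Oplus>\<^bsub>fiber_piece R \<mm> L n\<^esub> i \<in> {..n}. rcoset_mult R (K n) (f i) (g (n - i)))"
    by (simp add: fiber_cone_def)
  also have "\<dots> = (\<Oplus>\<^bsub>fiber_piece R \<mm> L n\<^esub> i \<in> {..n}. \<zero>\<^bsub>fiber_piece R \<mm> L n\<^esub>)"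
  proof (rule G.finsum_cong')
    fix i assume "i \<in> {..n}"
    thus "rcoset_mult R (K n) (f i) (g (n - i)) = \<zero>\<^bsub>fiber_piece R \<mm> L n\<^esub>"
      unfolding zero_piece using assms(3)[of i] by (intro rcoset_mult_zero[OF assms(1,2)]) simp_all
  qed simp_all
  also have "\<dots> = \<zero>\<^bsub>fiber_piece R \<mm> L n\<^esub>" by (rule G.finsum_zero)
  also have "\<dots> = K n" by (rule zero_piece)
  finally show ?thesis .
qed

text \<open>The last assumption kills every term of the convolution sum except the one at i. It is
  satisfied whenever one factor is homogeneous, which is the shape of the products computed
  below.\<close>

lemma mult_eqI:
  assumes "f \<in> carrier F" "g \<in> carrier F"
    and "x \<in> P i" "y \<in> P j" "f i = K i +> x" "g j = K j +> y"
    and "\<And>i'. i' \<le> i + j \<Longrightarrow> i' \<noteq> i \<Longrightarrow> f i' = K i' \<or> g (i + j - i') = K (i + j - i')"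
  shows "(f \<otimes>\<^bsub>F\<^esub> g) (i + j) = K (i + j) +> (x \<otimes> y)"
proof -
  define n where "n = i + j"
  define t where "t = (\<lambda>_::nat. K n +> (x \<otimes> y))"
  interpret G: abelian_group "fiber_piece R \<mm> L n" by (rule abelian_group_piece)
  have t: "t \<in> {..n} \<rightarrow> carrier (fiber_piece R \<mm> L n)"
    using P_mult_closed[OF assms(3,4)] by (auto simp: t_def n_def carrier_piece)
  have "(f \<otimes>\<^bsub>F\<^esub> g) n =
      (\<Oplus>\<^bsub>fiber_piece R \<mm> L n\<^esub> i \<in> {..n}. rcoset_mult R (K n) (f i) (g (n - i)))"
    by (simp add: fiber_cone_def)
  also have "\<dots> = (\<Oplus>\<^bsub>fiber_piece R \<mm> L n\<^esub> i' \<in> {..n}. if i = i' then t i' else \<zero>\<^bsub>fiber_piece R \<mm> L n\<^esub>)"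
  proof (rule G.finsum_cong')
    fix i' assume i': "i' \<in> {..n}"
    show "rcoset_mult R (K n) (f i') (g (n - i')) = (if i = i' then t i' else \<zero>\<^bsub>fiber_piece R \<mm> L n\<^esub>)"
    proof (cases "i = i'")
      case True
      have "rcoset_mult R (K n) (f i) (g j) = t i"
        unfolding assms(5,6) t_def n_def by (rule rcoset_mult_piece[OF assms(3,4)])
      thus ?thesis using True by (simp add: n_def)
    next
      case False
      thus ?thesis
        using i' assms(7)[of i'] rcoset_mult_zero[OF assms(1,2), of i' n] by (simp add: zero_piece n_def)
    qed
  qed (use t in auto)
  also have "\<dots> = t i" using t by (intro G.finsum_singleton) (simp_all add: n_def)
  finally show ?thesis by (simp add: n_def t_def)
qed

lemma class_mult:
  assumes "x \<in> P i" "f \<in> carrier F" "y \<in> P j" "f j = K j +> y"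
  shows "(cls i x \<otimes>\<^bsub>F\<^esub> f) (i + j) = K (i + j) +> (x \<otimes> y)"
  using assms by (intro mult_eqI class_closed) (auto simp: class_apply)

lemma class_mult_low:
  assumes "x \<in> P i" "f \<in> carrier F" "n < i"
  shows "(cls i x \<otimes>\<^bsub>F\<^esub> f) n = K n"
  using assms by (intro mult_zeroI class_closed) (auto simp: class_apply)

lemma mult_class:
  assumes "x \<in> P i" "f \<in> carrier F" "y \<in> P j" "f j = K j +> y"
  shows "(f \<otimes>\<^bsub>F\<^esub> cls i x) (j + i) = K (j + i) +> (y \<otimes> x)"
  using assms by (intro mult_eqI class_closed) (auto simp: class_apply)

lemma mult_class_low:
  assumes "x \<in> P i" "f \<in> carrier F" "n < i"
  shows "(f \<otimes>\<^bsub>F\<^esub> cls i x) n = K n"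
  using assms by (intro mult_zeroI class_closed) (auto simp: class_apply)

lemma class_mult_class:
  assumes "x \<in> P i" "y \<in> P j"
  shows "cls i x \<otimes>\<^bsub>F\<^esub> cls j y = cls (i + j) (x \<otimes> y)"
proof
  fix n
  show "(cls i x \<otimes>\<^bsub>F\<^esub> cls j y) n = cls (i + j) (x \<otimes> y) n"
  proof (cases "n = i + j")
    case True
    thus ?thesis using class_mult[OF assms(1) class_closed[OF assms(2)] assms(2)] by (simp add: class_apply)
  next
    case False
    have "(cls i x \<otimes>\<^bsub>F\<^esub> cls j y) n = K n"
      using False by (intro mult_zeroI class_closed assms) (auto simp: class_apply)
    thus ?thesis using False by (simp add: class_apply)
  qed
qed

end

section \<open>Additive structure of the fiber cone and multiplication by a homogeneous
  class\<close>

context fiber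
begin

lemma carrier_cone_iff:
  "f \<in> carrier F \<longleftrightarrow> (\<forall>n. f n \<in> carrier (fiber_piece R \<mm> L n)) \<and> finite {n. f n \<noteq> K n}"
  by (simp add: fiber_cone_def zero_piece)

lemma zero_cone: "\<zero>\<^bsub>F\<^esub> n = K n"
  by (simp add: fiber_cone_def zero_piece)

lemma add_cone: "(f \<oplus>\<^bsub>F\<^esub> g) n = f n \<oplus>\<^bsub>fiber_piece R \<mm> L n\<^esub> g n"
  by (simp add: fiber_cone_def)

text \<open>Lets zero be handled as a homogeneous class of whichever degree is at hand.\<close>

lemma zero_cone_eq_class: "\<zero>\<^bsub>F\<^esub> = cls n \<zero>"
  using class_eq_zero_iff[OF zero_in_P] zero_in_K by metis

text \<open>All laws hold componentwise; finiteness of support is what has to be checked. The group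
  structure makes the coset calculus for F(J)/a^jF(J) available.\<close>

lemma abelian_group_cone: "abelian_group F"
proof (rule abelian_groupI)
  note [simp] = abelian_group_piece[THEN abelian_group.axioms(1)]
  have zero_piece_r: "K n \<oplus>\<^bsub>fiber_piece R \<mm> L n\<^esub> K n = K n" for n
    using abelian_monoid.l_zero[OF abelian_group_piece[THEN abelian_group.axioms(1)], of _ n]
      abelian_monoid.zero_closed[OF abelian_group_piece[THEN abelian_group.axioms(1)], of n]
    by (simp add: zero_piece)
  show "f \<oplus>\<^bsub>F\<^esub> g \<in> carrier F" if "f \<in> carrier F" "g \<in> carrier F" for f g
  proof -
    have "{n. (f \<oplus>\<^bsub>F\<^esub> g) n \<noteq> K n} \<subseteq> {n. f n \<noteq> K n} \<union> {n. g n \<noteq> K n}"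
      using zero_piece_r by (auto simp: add_cone)
    moreover have "finite ({n. f n \<noteq> K n} \<union> {n. g n \<noteq> K n})"
      using that by (simp add: carrier_cone_iff)
    ultimately have "finite {n. (f \<oplus>\<^bsub>F\<^esub> g) n \<noteq> K n}"
      by (rule finite_subset)
    thus ?thesis
      using that by (simp add: carrier_cone_iff add_cone abelian_monoid.a_closed)
  qed
  show "\<zero>\<^bsub>F\<^esub> \<in> carrier F"
    using class_closed[OF zero_in_P] zero_cone_eq_class by metis
  fix f assume f: "f \<in> carrier F"
  show "\<zero>\<^bsub>F\<^esub> \<oplus>\<^bsub>F\<^esub> f = f"
  proof
    fix n
    have "f n \<in> carrier (fiber_piece R \<mm> L n)" using f by (simp add: carrier_cone_iff)
    thus "(\<zero>\<^bsub>F\<^esub> \<oplus>\<^bsub>F\<^esub> f) n = f n"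
      unfolding add_cone zero_cone zero_piece[symmetric] by (simp add: abelian_monoid.l_zero)
  qed
  define g where "g = (\<lambda>n. \<ominus>\<^bsub>fiber_piece R \<mm> L n\<^esub> f n)"
  have minus_K: "\<ominus>\<^bsub>fiber_piece R \<mm> L n\<^esub> K n = K n" for n
    using abelian_group.minus_equality[OF abelian_group_piece, of n "K n" "K n"] zero_piece_r
      abelian_monoid.zero_closed[OF abelian_group_piece[THEN abelian_group.axioms(1)], of n]
    by (simp add: zero_piece)
  have "{n. g n \<noteq> K n} \<subseteq> {n. f n \<noteq> K n}"
    using minus_K by (auto simp: g_def)
  moreover have "finite {n. f n \<noteq> K n}" using f by (simp add: carrier_cone_iff)
  ultimately have "finite {n. g n \<noteq> K n}" by (rule finite_subset)
  hence "g \<in> carrier F"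
    using f abelian_group.a_inv_closed[OF abelian_group_piece] by (simp add: carrier_cone_iff g_def)
  moreover have "g \<oplus>\<^bsub>F\<^esub> f = \<zero>\<^bsub>F\<^esub>"
  proof
    fix n
    have "f n \<in> carrier (fiber_piece R \<mm> L n)" using f by (simp add: carrier_cone_iff)
    thus "(g \<oplus>\<^bsub>F\<^esub> f) n = \<zero>\<^bsub>F\<^esub> n"
      unfolding add_cone zero_cone zero_piece[symmetric] g_def
      by (rule abelian_group.l_neg[OF abelian_group_piece])
  qed
  ultimately show "\<exists>g\<in>carrier F. g \<oplus>\<^bsub>F\<^esub> f = \<zero>\<^bsub>F\<^esub>" by blast
qed (auto simp: fun_eq_iff add_cone carrier_cone_iff
      abelian_monoid.a_assoc[OF abelian_group_piece[THEN abelian_group.axioms(1)]]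
      abelian_monoid.a_comm[OF abelian_group_piece[THEN abelian_group.axioms(1)]])

text \<open>The inverse in the cone is defined by description, so its components are identified
  through uniqueness of inverses in each graded piece.\<close>

lemma minus_cone:
  assumes "f \<in> carrier F"
  shows "(\<ominus>\<^bsub>F\<^esub> f) n = \<ominus>\<^bsub>fiber_piece R \<mm> L n\<^esub> f n"
proof -
  have closed: "(\<ominus>\<^bsub>F\<^esub> f) n \<in> carrier (fiber_piece R \<mm> L n)" "f n \<in> carrier (fiber_piece R \<mm> L n)"
    using abelian_group.a_inv_closed[OF abelian_group_cone assms] assms
    unfolding carrier_cone_iff by simp_all
  have "(\<ominus>\<^bsub>F\<^esub> f) n \<oplus>\<^bsub>fiber_piece R \<mm> L n\<^esub> f n = \<zero>\<^bsub>fiber_piece R \<mm> L n\<^esub>"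
    using abelian_group.l_neg[OF abelian_group_cone assms] add_cone[of "\<ominus>\<^bsub>F\<^esub> f" f n]
    by (simp add: zero_cone zero_piece)
  thus ?thesis
    using abelian_group.minus_equality[OF abelian_group_piece] closed by metis
qed

lemma class_mult_closed:
  assumes x: "x \<in> P i" and f: "f \<in> carrier F"
  shows "cls i x \<otimes>\<^bsub>F\<^esub> f \<in> carrier F"
proof -
  have zero: "(cls i x \<otimes>\<^bsub>F\<^esub> f) (i + n) = K (i + n)" if "f n = K n" for n
    using that by (intro mult_zeroI class_closed assms) (auto simp: class_apply)
  \<comment> \<open>Multiplication by a class of degree i moves the support up by i, so it remains
    finite.\<close>
  have "{n. (cls i x \<otimes>\<^bsub>F\<^esub> f) n \<noteq> K n} \<subseteq> (\<lambda>n. i + n) ` {n. f n \<noteq> K n}"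
  proof
    fix n assume n: "n \<in> {n. (cls i x \<otimes>\<^bsub>F\<^esub> f) n \<noteq> K n}"
    hence "i \<le> n" using class_mult_low[OF assms, of n] by (auto simp: not_less[symmetric])
    hence "n = i + (n - i)" by simp
    thus "n \<in> (\<lambda>n. i + n) ` {n. f n \<noteq> K n}" using n zero[of "n - i"] by auto
  qed
  moreover have "finite {n. f n \<noteq> K n}" using f by (simp add: carrier_cone_iff)
  ultimately have "finite {n. (cls i x \<otimes>\<^bsub>F\<^esub> f) n \<noteq> K n}"
    by (meson finite_imageI finite_subset)
  moreover have "(cls i x \<otimes>\<^bsub>F\<^esub> f) n \<in> carrier (fiber_piece R \<mm> L n)" for n
  proof (cases "n < i")
    case True
    thus ?thesis
      using class_mult_low[OF assms True] zero_in_P[of n] K_rcos_zero[of n] by (auto simp: carrier_piece)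
  next
    case False
    hence n: "n = i + (n - i)" by simp
    obtain y where "y \<in> P (n - i)" "f (n - i) = K (n - i) +> y"
      by (rule carrier_coneD[OF f])
    hence "(cls i x \<otimes>\<^bsub>F\<^esub> f) (i + (n - i)) \<in> carrier (fiber_piece R \<mm> L (i + (n - i)))"
      using class_mult[OF x f] P_mult_closed[OF x] by (simp add: carrier_piece)
    thus ?thesis using n by simp
  qed
  ultimately show ?thesis by (simp add: carrier_cone_iff)
qed

text \<open>Component n of the product depends on component n - i of the factor only. Agreement
  below degree j is thus preserved, which makes the action on F(J)/a^jF(J) well defined.\<close>

lemma class_mult_cong:
  assumes x: "x \<in> P i" and f: "f \<in> carrier F" and g: "g \<in> carrier F" and "\<And>n. n < j \<Longrightarrow> f n = g n" "n < j"
  shows "(cls i x \<otimes>\<^bsub>F\<^esub> f) n = (cls i x \<otimes>\<^bsub>F\<^esub> g) n"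
proof (cases "n < i")
  case True
  thus ?thesis using class_mult_low x f g by simp
next
  case False
  hence n: "n = i + (n - i)" by simp
  obtain y where y: "y \<in> P (n - i)" "f (n - i) = K (n - i) +> y"
    by (rule carrier_coneD[OF f])
  moreover have "g (n - i) = K (n - i) +> y" using y(2) assms(4)[of "n - i"] assms(5) by simp
  ultimately show ?thesis using class_mult[OF x f y(1)] class_mult[OF x g y(1)] n by metis
qed

lemma hcomp_fiber_module:
  "hcomp (fiber_module R \<mm> L) n = cls n ` P n"
proof (intro equalityI subsetI)
  fix f assume f: "f \<in> hcomp (fiber_module R \<mm> L) n"
  hence fc: "f \<in> carrier F" and z: "i \<noteq> n \<Longrightarrow> f i = K i" for i
    by (auto simp: fiber_module_def zero_piece)
  obtain x where x: "x \<in> P n" "f n = K n +> x" by (rule carrier_coneD[OF fc])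
  hence "f = cls n x" using z by (auto simp: fun_eq_iff class_apply)
  thus "f \<in> cls n ` P n" using x by simp
next
  fix f assume "f \<in> cls n ` P n"
  thus "f \<in> hcomp (fiber_module R \<mm> L) n"
    using class_closed by (auto simp: fiber_module_def zero_piece class_apply)
qed

end

lemma ideal_pow_mono:
  assumes "J \<subseteq> I"
  shows "ideal_pow R J n \<subseteq> ideal_pow R I n"
proof (induction n)
  case (Suc n)
  have "ideal_prod R (ideal_pow R J n) J \<subseteq> ideal_prod R (ideal_pow R I n) I"
  proof
    fix z assume "z \<in> ideal_prod R (ideal_pow R J n) J"
    thus "z \<in> ideal_prod R (ideal_pow R I n) I"
      by (induction rule: ideal_prod.induct) (use Suc assms in \<open>auto intro: ideal_prod.intros\<close>)
  qed
  thus ?case by (simp add: ideals_set_def)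
qed simp

text \<open>The union in \<open>fiber_map\<close> collapses to one coset because
  \<open>\<mm>\<close> J^n \<subseteq> \<open>\<mm>\<close> I^n. For J = I it says that the natural
  map fixes homogeneous classes, so that F(J) acts on itself by multiplication.\<close>

lemma (in cring) fiber_map_class:
  assumes J: "fiber R \<mm> J" and I: "fiber R \<mm> I" and "J \<subseteq> I" and x: "x \<in> ideal_pow R J i"
  shows "fiber_map R \<mm> I (fiber_class R \<mm> J i x) = fiber_class R \<mm> I i x"
proof
  interpret J: fiber R \<mm> J by (rule J)
  interpret I: fiber R \<mm> I by (rule I)
  fix n
  have K_mono: "J.K n \<subseteq> I.K n" for n
  proof
    fix z assume "z \<in> J.K n"
    thus "z \<in> I.K n"
      by (induction rule: ideal_prod.induct) (use ideal_pow_mono[OF \<open>J \<subseteq> I\<close>] in \<open>auto intro: ideal_prod.intros\<close>)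
  qed
  have coset: "(\<Union>z \<in> J.K n +> y. I.K n +> z) = I.K n +> y" if y: "y \<in> carrier R" for n y
  proof (rule UN_constant_eq[of y])
    show "y \<in> J.K n +> y"
      using abelian_subgroup.a_rcos_self[OF abelian_subgroupI3[OF ideal.axioms(1)[OF J.K_ideal] abelian_group_axioms]] y .
    show "\<forall>z\<in>J.K n +> y. I.K n +> z = I.K n +> y"
    proof
      fix z assume "z \<in> J.K n +> y"
      hence "\<exists>h\<in>J.K n. z = h \<oplus> y" by (simp add: a_r_coset_def')
      then obtain h where h: "h \<in> J.K n" "z = h \<oplus> y" by (elim bexE)
      hence "h \<in> I.K n" using K_mono by blast
      hence "z \<in> I.K n +> y" using h(2) by (auto simp: a_r_coset_def')
      thus "I.K n +> z = I.K n +> y"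
        using abelian_subgroup.a_repr_independence'[OF abelian_subgroupI3[OF ideal.axioms(1)[OF I.K_ideal] abelian_group_axioms]] y
        by metis
    qed
  qed
  show "fiber_map R \<mm> I (J.cls i x) n = I.cls i x n"
  proof (cases "n = i")
    case True
    thus ?thesis using coset[OF J.P_carrier[OF x]] by (simp add: fiber_map_def J.class_apply I.class_apply)
  next
    case False
    thus ?thesis using coset[OF zero_closed, of n] J.K_rcos_zero[of n] I.K_rcos_zero[of n]
      by (simp add: fiber_map_def J.class_apply I.class_apply)
  qed
qed

section \<open>The fiber cone of a principal ideal\<close>

lemma abelian_group_minus_eq_zero_iff:
  fixes G (structure)
  assumes "abelian_group G" "x \<in> carrier G" "y \<in> carrier G"
  shows "x \<ominus> y = \<zero> \<longleftrightarrow> x = y"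
proof -
  interpret abelian_group G by fact
  show ?thesis using assms(2,3) minus_equality[of x "\<ominus> y"] by (auto simp: a_minus_def r_neg)
qed

text \<open>\<open>PIdl\<close> writes multiples with the generator on the right, while the scalar
  action and the rules above put the homogeneous class on the left.\<close>

lemma (in fiber) mult_class_commute:
  assumes "x \<in> P i" "f \<in> carrier F"
  shows "f \<otimes>\<^bsub>F\<^esub> cls i x = cls i x \<otimes>\<^bsub>F\<^esub> f"
proof
  fix n
  show "(f \<otimes>\<^bsub>F\<^esub> cls i x) n = (cls i x \<otimes>\<^bsub>F\<^esub> f) n"
  proof (cases "n < i")
    case True
    thus ?thesis using class_mult_low mult_class_low assms by simp
  next
    case False
    obtain y where y: "y \<in> P (n - i)" "f (n - i) = K (n - i) +> y"
      by (rule carrier_coneD[OF assms(2)])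
    have n: "i + (n - i) = n" "(n - i) + i = n" using False by simp_all
    show ?thesis
      using class_mult[OF assms y] mult_class[OF assms y] m_comm[OF P_carrier P_carrier, OF assms(1) y(1)]
      unfolding n by simp
  qed
qed

locale principal_fiber = cring R for R (structure) +
  fixes \<mm> :: "'a set" and a :: 'a
  assumes m_ideal: "ideal \<mm> R" and nzd: "nonzerodivisor R a"

sublocale principal_fiber \<subseteq> fiber R \<mm> "PIdl a"
  using nzd
  by (intro fiber.intro fiber_axioms.intro cring_axioms m_ideal cgenideal_ideal)
    (simp add: nonzerodivisor_def)

context principal_fiber
begin

definition T :: "nat \<Rightarrow> (nat \<Rightarrow> 'a set) set" where
  "T j = PIdl\<^bsub>F\<^esub> (cls 1 a [^]\<^bsub>F\<^esub> j)"

abbreviation tor :: "nat \<Rightarrow> (nat \<Rightarrow> 'a set, (nat \<Rightarrow> 'a set) set) graded_module" where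
  "tor j \<equiv> fiber_torsion R \<mm> (PIdl a) a j"

text \<open>Parametrises degree n of F(J)/a^jF(J) by a ring element c, so that coordinates can be
  taken in the ring and compared modulo \<open>\<mm>\<close>.\<close>

definition tcls :: "nat \<Rightarrow> nat \<Rightarrow> 'a \<Rightarrow> (nat \<Rightarrow> 'a set) set" where
  "tcls j n c = T j +>\<^bsub>F\<^esub> cls n (c \<otimes> a [^] n)"

lemma a_closed: "a \<in> carrier R"
  using nzd by (simp add: nonzerodivisor_def)

lemma a_pow_closed: "a [^] (n::nat) \<in> carrier R"
  by (rule nat_pow_closed[OF a_closed])

lemma a_pow_cancel:
  assumes "c \<in> carrier R" "d \<in> carrier R" "c \<otimes> a [^] (n::nat) = d \<otimes> a [^] n"
  shows "c = d"
  using assms(3)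
proof (induction n)
  case (Suc n)
  define e where "e = c \<otimes> a [^] n \<ominus> d \<otimes> a [^] n"
  have e: "e \<in> carrier R" using assms(1,2) a_pow_closed by (simp add: e_def)
  have "c \<otimes> (a [^] n \<otimes> a) = d \<otimes> (a [^] n \<otimes> a)" using Suc.prems by simp
  hence "c \<otimes> (a [^] n \<otimes> a) \<ominus> d \<otimes> (a [^] n \<otimes> a) = \<zero>"
    using assms(1,2) a_pow_closed a_closed by (simp add: r_neg a_minus_def)
  moreover have "a \<otimes> e = c \<otimes> (a [^] n \<otimes> a) \<ominus> d \<otimes> (a [^] n \<otimes> a)"
    unfolding e_def using assms(1,2) a_pow_closed[of n] a_closed by algebra
  ultimately have "e = \<zero>" using nzd e by (simp add: nonzerodivisor_def)
  hence "c \<otimes> a [^] n = d \<otimes> a [^] n"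
    using assms(1,2) a_pow_closed unfolding e_def by simp
  thus ?case by (rule Suc.IH)
qed (use assms in simp)

lemma P_eq: "P n = PIdl (a [^] n)"
proof (induction n)
  case 0
  have "PIdl \<one> = carrier R"
    using ideal.one_imp_carrier[OF cgenideal_ideal cgenideal_self] by simp
  thus ?case by (simp add: ideals_set_def)
next
  case (Suc n)
  have "P (Suc n) = ideal_prod R (P n) (PIdl a)" by (simp add: ideals_set_def)
  also have "\<dots> = PIdl (a [^] n \<otimes> a)"
  proof -
    have I: "ideal (PIdl (a [^] n \<otimes> a)) R" by (intro cgenideal_ideal m_closed a_pow_closed a_closed)
    have "ideal_prod R (P n) (PIdl a) = Idl (PIdl (a [^] n) <#> PIdl a)"
      using ideal_prod_eq_genideal[OF P_ideal[of n] L_ideal] Suc by simp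
    also have "\<dots> = Idl (PIdl (a [^] n \<otimes> a))"
      by (simp only: cgenideal_prod[OF a_pow_closed a_closed])
    also have "\<dots> = PIdl (a [^] n \<otimes> a)"
      using genideal_minimal[OF I subset_refl] genideal_self[of "PIdl (a [^] n \<otimes> a)"] ideal.Icarr[OF I]
      by blast
    finally show ?thesis .
  qed
  finally show ?case by simp
qed

lemma P_iff: "x \<in> P n \<longleftrightarrow> (\<exists>c\<in>carrier R. x = c \<otimes> a [^] n)"
  unfolding P_eq by (auto simp: cgenideal_def)

lemma multiple_in_P: "c \<in> carrier R \<Longrightarrow> c \<otimes> a [^] n \<in> P n"
  unfolding P_iff by blast

text \<open>Elements of \<open>\<mm>\<close> a^n have the form d a^n with d in \<open>\<mm>\<close>,
  and a^n cancels because a is a non-zero-divisor. Hence each graded piece of F(J) is a copy of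
  A/\<open>\<mm>\<close> through the coefficient c.\<close>

lemma multiple_in_K_iff:
  assumes "c \<in> carrier R"
  shows "c \<otimes> a [^] n \<in> K n \<longleftrightarrow> c \<in> \<mm>"
proof
  interpret m: ideal \<mm> R by (rule m_ideal)
  have "\<exists>d\<in>\<mm>. x = d \<otimes> a [^] n" if "x \<in> K n" for x
    using that
  proof (induction rule: ideal_prod.induct)
    case (prod i j)
    then obtain c where c: "c \<in> carrier R" "j = c \<otimes> a [^] n" by (auto simp: P_iff)
    have "i \<otimes> j = (i \<otimes> c) \<otimes> a [^] n"
      unfolding c(2) using m_assoc[OF m.Icarr[OF prod(1)] c(1) a_pow_closed] by simp
    thus ?case using m.I_r_closed[OF prod(1) c(1)] by blast
  next
    case (sum s1 s2)
    then obtain d e where de: "d \<in> \<mm>" "e \<in> \<mm>" "s1 = d \<otimes> a [^] n" "s2 = e \<otimes> a [^] n" by blast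
    hence "s1 \<oplus> s2 = (d \<oplus> e) \<otimes> a [^] n"
      using l_distr[OF m.Icarr m.Icarr a_pow_closed] by simp
    thus ?case using m.a_closed[OF de(1,2)] by blast
  qed
  moreover assume "c \<otimes> a [^] n \<in> K n"
  ultimately obtain d where d: "d \<in> \<mm>" "c \<otimes> a [^] n = d \<otimes> a [^] n" by blast
  have "c = d" by (rule a_pow_cancel[OF assms m.Icarr[OF d(1)] d(2)])
  thus "c \<in> \<mm>" using d(1) by simp
next
  assume "c \<in> \<mm>"
  moreover have "a [^] n \<in> P n" unfolding P_eq by (rule cgenideal_self[OF a_pow_closed])
  ultimately show "c \<otimes> a [^] n \<in> K n" by (rule ideal_prod.prod)
qed

lemma a_in_P_1: "a \<in> P 1"
  unfolding P_eq using cgenideal_self[OF a_closed] a_closed by simp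

lemma a_pow_in_P: "a [^] n \<in> P n"
  unfolding P_eq by (rule cgenideal_self[OF a_pow_closed])

lemma class_a_pow: "cls 1 a [^]\<^bsub>F\<^esub> j = cls j (a [^] j)"
proof (induction j)
  case 0
  show ?case by (simp add: fiber_cone_def)
next
  case (Suc j)
  have "cls 1 a [^]\<^bsub>F\<^esub> Suc j = cls j (a [^] j) \<otimes>\<^bsub>F\<^esub> cls 1 a" using Suc by simp
  also have "\<dots> = cls (j + 1) (a [^] j \<otimes> a)" by (rule class_mult_class[OF a_pow_in_P a_in_P_1])
  finally show ?case by simp
qed

text \<open>Each component is the class of a multiple c a^n, so an element without components below
  degree j can be divided by a^j degree by degree. The quotient by \<open>T j\<close> is therefore
  truncation at degree j.\<close>

lemma T_iff: "f \<in> T j \<longleftrightarrow> f \<in> carrier F \<and> (\<forall>n<j. f n = K n)"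
proof
  assume "f \<in> T j"
  then obtain g where g: "g \<in> carrier F" "f = g \<otimes>\<^bsub>F\<^esub> cls j (a [^] j)"
    unfolding T_def cgenideal_def[of F] class_a_pow by blast
  show "f \<in> carrier F \<and> (\<forall>n<j. f n = K n)"
    unfolding g(2) mult_class_commute[OF a_pow_in_P g(1)]
    using class_mult_closed[OF a_pow_in_P g(1)] class_mult_low[OF a_pow_in_P g(1)] by blast
next
  assume f: "f \<in> carrier F \<and> (\<forall>n<j. f n = K n)"
  have "\<exists>c. c \<in> carrier R \<and> f n = K n +> (c \<otimes> a [^] n)" for n
  proof -
    obtain x where "x \<in> P n" "f n = K n +> x" using f by (elim conjE carrier_coneD)
    thus ?thesis unfolding P_iff by blast
  qed
  then obtain c where c: "\<And>n. c n \<in> carrier R" "\<And>n. f n = K n +> (c n \<otimes> a [^] n)" by metis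
  \<comment> \<open>The quotient by a^j: the same coefficients, moved down by j degrees.\<close>
  define g where "g = (\<lambda>n. K n +> (c (j + n) \<otimes> a [^] n))"
  \<comment> \<open>Whether a component vanishes depends on its coefficient and not on the degree,
    so g inherits finite support from f.\<close>
  have coset_eq: "K n +> (c i \<otimes> a [^] n) = K n \<longleftrightarrow> c i \<in> \<mm>" for i n
    using rcos_eq_self_iff[OF K_ideal P_carrier[OF multiple_in_P]] multiple_in_K_iff c(1) by simp
  have "{n. g n \<noteq> K n} = (\<lambda>n. j + n) -` {n. f n \<noteq> K n}"
    unfolding g_def c(2) coset_eq by auto
  hence "finite {n. g n \<noteq> K n}"
    using f finite_vimageI[of "{n. f n \<noteq> K n}" "\<lambda>n. j + n"] by (simp add: carrier_cone_iff)
  hence g: "g \<in> carrier F"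
    using multiple_in_P[OF c(1)] by (auto simp: carrier_cone_iff carrier_piece g_def)
  have "f = cls j (a [^] j) \<otimes>\<^bsub>F\<^esub> g"
  proof
    fix n
    show "f n = (cls j (a [^] j) \<otimes>\<^bsub>F\<^esub> g) n"
    proof (cases "n < j")
      case True
      thus ?thesis using f class_mult_low[OF a_pow_in_P g] by simp
    next
      case False
      define i where "i = n - j"
      have n: "n = j + i" using False by (simp add: i_def)
      have "a [^] j \<otimes> (c (j + i) \<otimes> a [^] i) = c (j + i) \<otimes> (a [^] j \<otimes> a [^] i)"
        using c(1) a_pow_closed by (intro m_lcomm)
      also have "\<dots> = c (j + i) \<otimes> a [^] (j + i)" by (simp only: nat_pow_mult[OF a_closed])
      finally show ?thesis
        unfolding n class_mult[OF a_pow_in_P g multiple_in_P[OF c(1)] fun_cong[OF g_def]] c(2) by simp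
    qed
  qed
  hence "f = g \<otimes>\<^bsub>F\<^esub> cls j (a [^] j)" by (simp only: mult_class_commute[OF a_pow_in_P g])
  thus "f \<in> T j" using g unfolding T_def cgenideal_def[of F] class_a_pow by blast
qed

lemma additive_subgroup_T: "additive_subgroup (T j) F"
proof (rule additive_subgroupI, rule group.subgroupI[OF abelian_group.a_group[OF abelian_group_cone]])
  have zero: "K n \<oplus>\<^bsub>fiber_piece R \<mm> (PIdl a) n\<^esub> K n = K n" for n
    using add_piece[OF zero_in_P zero_in_P] K_rcos_zero by (metis l_zero zero_closed)
  show "T j \<subseteq> carrier (add_monoid F)" by (auto simp: T_iff)
  have "\<zero>\<^bsub>F\<^esub> \<in> T j"
    using zero_cone abelian_monoid.zero_closed[OF abelian_group.axioms(1)[OF abelian_group_cone]] by (simp add: T_iff)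
  thus "T j \<noteq> {}" by blast
  fix f g assume f: "f \<in> T j" and g: "g \<in> T j"
  have "f \<oplus>\<^bsub>F\<^esub> g \<in> T j"
    using f g zero abelian_monoid.a_closed[OF abelian_group.axioms(1)[OF abelian_group_cone]]
    by (simp add: T_iff add_cone)
  thus "f \<otimes>\<^bsub>add_monoid F\<^esub> g \<in> T j" by simp
  have "\<ominus>\<^bsub>fiber_piece R \<mm> (PIdl a) n\<^esub> K n = K n" for n
    using abelian_group.minus_equality[OF abelian_group_piece, of n "K n" "K n"] zero
      abelian_monoid.zero_closed[OF abelian_group_piece[THEN abelian_group.axioms(1)], of n]
    by (simp add: zero_piece)
  hence "\<ominus>\<^bsub>F\<^esub> f \<in> T j"
    using f abelian_group.a_inv_closed[OF abelian_group_cone] by (simp add: T_iff minus_cone)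
  thus "inv\<^bsub>add_monoid F\<^esub> f \<in> T j" by (simp add: a_inv_def)
qed

lemma abelian_subgroup_T: "abelian_subgroup (T j) F"
  by (rule abelian_subgroupI3[OF additive_subgroup_T abelian_group_cone])

text \<open>Makes the truncation explicit: cosets of \<open>T j\<close> are compared through
  finitely many components, without exhibiting multiples of a^j.\<close>

lemma T_coset_eq_iff:
  assumes "f \<in> carrier F" "g \<in> carrier F"
  shows "T j +>\<^bsub>F\<^esub> f = T j +>\<^bsub>F\<^esub> g \<longleftrightarrow> (\<forall>n<j. f n = g n)"
proof -
  interpret F: abelian_group F by (rule abelian_group_cone)
  have "T j +>\<^bsub>F\<^esub> f = T j +>\<^bsub>F\<^esub> g \<longleftrightarrow> f \<in> T j +>\<^bsub>F\<^esub> g"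
    using abelian_subgroup.a_repr_independence'[OF abelian_subgroup_T _ assms(2)]
      abelian_subgroup.a_repr_independenceD[OF abelian_subgroup_T assms(1)] by metis
  also have "\<dots> \<longleftrightarrow> f \<ominus>\<^bsub>F\<^esub> g \<in> T j"
    using abelian_subgroup.a_rcos_module[OF abelian_subgroup_T assms(2,1)] by (simp only: a_minus_def)
  also have "\<dots> \<longleftrightarrow> (\<forall>n<j. f n = g n)"
  proof -
    have "(f \<ominus>\<^bsub>F\<^esub> g) n = K n \<longleftrightarrow> f n = g n" for n
    proof -
      interpret G: abelian_group "fiber_piece R \<mm> (PIdl a) n" by (rule abelian_group_piece)
      have "(f \<ominus>\<^bsub>F\<^esub> g) n = f n \<ominus>\<^bsub>fiber_piece R \<mm> (PIdl a) n\<^esub> g n"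
        using minus_cone[OF assms(2)] by (simp add: a_minus_def add_cone)
      moreover have "f n \<in> carrier (fiber_piece R \<mm> (PIdl a) n)" "g n \<in> carrier (fiber_piece R \<mm> (PIdl a) n)"
        using assms by (simp_all add: carrier_cone_iff)
      ultimately show ?thesis
        using abelian_group_minus_eq_zero_iff[OF abelian_group_piece] zero_piece by metis
    qed
    thus ?thesis using F.minus_closed[OF assms] by (simp add: T_iff)
  qed
  finally show ?thesis .
qed

section \<open>Homogeneous elements of the torsion modules F(J)/a^jF(J)\<close>

lemma tor_simps:
  "\<zero>\<^bsub>tor j\<^esub> = T j"
  "hcomp (tor j) n = (\<lambda>f. T j +>\<^bsub>F\<^esub> f) ` hcomp (fiber_module R \<mm> (PIdl a)) n"
  "X \<oplus>\<^bsub>tor j\<^esub> Y = X <+>\<^bsub>F\<^esub> Y"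
  "s \<odot>\<^bsub>tor j\<^esub> X = (\<Union>x\<in>X. T j +>\<^bsub>F\<^esub> (fiber_map R \<mm> (PIdl a) s \<otimes>\<^bsub>F\<^esub> x))"
  by (simp_all add: fiber_torsion_def gm_quot_def quot_module_def module.defs graded_module.defs
      T_def fiber_module_def a_r_coset_def r_coset_def set_add_def set_mult_def)

lemma class_multiple_closed: "c \<in> carrier R \<Longrightarrow> cls n (c \<otimes> a [^] n) \<in> carrier F"
  by (rule class_closed[OF multiple_in_P])

lemma hcomp_fiber: "hcomp (fiber_module R \<mm> (PIdl a)) n = (\<lambda>c. cls n (c \<otimes> a [^] n)) ` carrier R"
proof -
  have "P n = (\<lambda>c. c \<otimes> a [^] n) ` carrier R" using P_iff by blast
  thus ?thesis unfolding hcomp_fiber_module by (simp add: image_image)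
qed

lemma class_multiple_eq_zero_iff:
  "c \<in> carrier R \<Longrightarrow> cls n (c \<otimes> a [^] n) = \<zero>\<^bsub>F\<^esub> \<longleftrightarrow> c \<in> \<mm>"
  using class_eq_zero_iff[OF multiple_in_P] multiple_in_K_iff by simp

lemma class_multiple_mult:
  assumes "c \<in> carrier R" "d \<in> carrier R"
  shows "cls i (d \<otimes> a [^] i) \<otimes>\<^bsub>F\<^esub> cls n (c \<otimes> a [^] n) = cls (i + n) ((d \<otimes> c) \<otimes> a [^] (i + n))"
proof -
  have "(d \<otimes> a [^] i) \<otimes> (c \<otimes> a [^] n) = (d \<otimes> c) \<otimes> (a [^] i \<otimes> a [^] n)"
    using assms a_pow_closed[of i] a_pow_closed[of n] by algebra
  thus ?thesis
    using class_mult_class[OF multiple_in_P multiple_in_P] assms nat_pow_mult[OF a_closed] by simp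
qed

text \<open>Below degree j truncation loses nothing and \<open>multiple_in_K_iff\<close> decides;
  from degree j on every class is truncated away.\<close>

lemma tcls_eq_iff:
  assumes "c \<in> carrier R" "d \<in> carrier R"
  shows "tcls j n c = tcls j n d \<longleftrightarrow> c \<ominus> d \<in> \<mm> \<or> j \<le> n"
proof -
  have "tcls j n c = tcls j n d \<longleftrightarrow> (\<forall>n'<j. cls n (c \<otimes> a [^] n) n' = cls n (d \<otimes> a [^] n) n')"
    unfolding tcls_def by (rule T_coset_eq_iff) (intro class_multiple_closed assms)+
  also have "\<dots> \<longleftrightarrow> cls n (c \<otimes> a [^] n) = cls n (d \<otimes> a [^] n) \<or> j \<le> n"
    by (auto simp: class_apply fun_eq_iff not_less[symmetric])
  also have "cls n (c \<otimes> a [^] n) = cls n (d \<otimes> a [^] n) \<longleftrightarrow> c \<otimes> a [^] n \<ominus> d \<otimes> a [^] n \<in> K n"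
    by (intro class_eq_iff multiple_in_P assms)
  also have "c \<otimes> a [^] n \<ominus> d \<otimes> a [^] n = (c \<ominus> d) \<otimes> a [^] n"
    using assms a_pow_closed[of n] by algebra
  also have "(c \<ominus> d) \<otimes> a [^] n \<in> K n \<longleftrightarrow> c \<ominus> d \<in> \<mm>"
    using assms by (intro multiple_in_K_iff) simp
  finally show ?thesis .
qed

lemma tcls_zero: "tcls j n \<zero> = T j"
proof -
  have "tcls j n \<zero> = T j +>\<^bsub>F\<^esub> \<zero>\<^bsub>F\<^esub>"
    using zero_cone_eq_class[of n] a_pow_closed[of n] by (simp add: tcls_def)
  also have "\<dots> = T j"
    using abelian_group.a_coset_join2[OF abelian_group_cone _ additive_subgroup.a_subgroup[OF additive_subgroup_T]]
      additive_subgroup.zero_closed[OF additive_subgroup_T]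
      abelian_monoid.zero_closed[OF abelian_group.axioms(1)[OF abelian_group_cone]] by metis
  finally show ?thesis .
qed

lemma tcls_eq_zero_iff:
  assumes "c \<in> carrier R"
  shows "tcls j n c = T j \<longleftrightarrow> c \<in> \<mm> \<or> j \<le> n"
  using tcls_eq_iff[OF assms zero_closed, of j n] assms by (simp add: tcls_zero a_minus_def)

lemma hcomp_tor: "hcomp (tor j) n = tcls j n ` carrier R"
  unfolding tor_simps hcomp_fiber tcls_def by (simp add: image_image)

lemma tcls_add:
  assumes "c \<in> carrier R" "d \<in> carrier R"
  shows "tcls j n c \<oplus>\<^bsub>tor j\<^esub> tcls j n d = tcls j n (c \<oplus> d)"
proof -
  have "tcls j n c \<oplus>\<^bsub>tor j\<^esub> tcls j n d = T j +>\<^bsub>F\<^esub> (cls n (c \<otimes> a [^] n) \<oplus>\<^bsub>F\<^esub> cls n (d \<otimes> a [^] n))"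
    unfolding tor_simps tcls_def
    by (rule abelian_subgroup.a_rcos_sum[OF abelian_subgroup_T]) (intro class_multiple_closed assms)+
  also have "cls n (c \<otimes> a [^] n) \<oplus>\<^bsub>F\<^esub> cls n (d \<otimes> a [^] n) = cls n ((c \<oplus> d) \<otimes> a [^] n)"
    using class_add[OF multiple_in_P multiple_in_P] assms l_distr[OF assms a_pow_closed] by simp
  finally show ?thesis by (simp only: tcls_def)
qed

lemma tcls_smult:
  assumes "c \<in> carrier R" "d \<in> carrier R"
  shows "cls i (d \<otimes> a [^] i) \<odot>\<^bsub>tor j\<^esub> tcls j n c = tcls j (i + n) (d \<otimes> c)"
proof -
  define s f where "s = cls i (d \<otimes> a [^] i)" and "f = cls n (c \<otimes> a [^] n)"
  have f: "f \<in> carrier F" unfolding f_def by (rule class_multiple_closed[OF assms(1)])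
  have dP: "d \<otimes> a [^] i \<in> P i" by (rule multiple_in_P[OF assms(2)])
  have "s \<odot>\<^bsub>tor j\<^esub> tcls j n c = (\<Union>x\<in>T j +>\<^bsub>F\<^esub> f. T j +>\<^bsub>F\<^esub> (s \<otimes>\<^bsub>F\<^esub> x))"
    using fiber_map_class[OF fiber_axioms fiber_axioms subset_refl dP]
    by (simp add: tor_simps tcls_def s_def f_def)
  \<comment> \<open>Scalar multiplication on the quotient is a union over a coset. Members of the
    coset agree below degree j, hence so do their multiples, and all the cosets in the union
    coincide.\<close>
  also have "\<dots> = T j +>\<^bsub>F\<^esub> (s \<otimes>\<^bsub>F\<^esub> f)"
  proof (rule UN_constant_eq)
    show "f \<in> T j +>\<^bsub>F\<^esub> f" by (rule abelian_subgroup.a_rcos_self[OF abelian_subgroup_T f])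
    show "\<forall>x\<in>T j +>\<^bsub>F\<^esub> f. T j +>\<^bsub>F\<^esub> (s \<otimes>\<^bsub>F\<^esub> x) = T j +>\<^bsub>F\<^esub> (s \<otimes>\<^bsub>F\<^esub> f)"
    proof
      fix x assume x: "x \<in> T j +>\<^bsub>F\<^esub> f"
      have xF: "x \<in> carrier F"
        using x abelian_subgroup.a_elemrcos_carrier[OF abelian_subgroup_T f] by blast
      have "T j +>\<^bsub>F\<^esub> x = T j +>\<^bsub>F\<^esub> f"
        using abelian_subgroup.a_repr_independence'[OF abelian_subgroup_T x f] by simp
      hence "\<forall>n<j. x n = f n" using T_coset_eq_iff[OF xF f] by simp
      hence "\<forall>n<j. (s \<otimes>\<^bsub>F\<^esub> x) n = (s \<otimes>\<^bsub>F\<^esub> f) n"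
        unfolding s_def using class_mult_cong[OF dP xF f] by blast
      thus "T j +>\<^bsub>F\<^esub> (s \<otimes>\<^bsub>F\<^esub> x) = T j +>\<^bsub>F\<^esub> (s \<otimes>\<^bsub>F\<^esub> f)"
        using T_coset_eq_iff class_mult_closed[OF dP xF] class_mult_closed[OF dP f] by (simp add: s_def)
    qed
  qed
  also have "s \<otimes>\<^bsub>F\<^esub> f = cls (i + n) ((d \<otimes> c) \<otimes> a [^] (i + n))"
    unfolding s_def f_def by (rule class_multiple_mult[OF assms])
  finally show ?thesis by (simp only: tcls_def s_def)
qed

end

section \<open>The graded decomposition\<close>

lemma PiE_eq_restrict:
  assumes "x \<in> Pi\<^sub>E S Y" "\<And>i. i \<in> S \<Longrightarrow> x i = y i"
  shows "x = restrict y S"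
proof
  fix i show "x i = restrict y S i" using assms(2)[of i] PiE_arb[OF assms(1), of i] by simp
qed

context principal_fiber
begin

abbreviation D :: "nat \<Rightarrow> (nat \<Rightarrow> nat) \<Rightarrow> (nat \<Rightarrow> nat \<Rightarrow> nat) \<Rightarrow>
     (nat \<Rightarrow> 'a set, (nat \<Rightarrow> nat \<Rightarrow> nat \<Rightarrow> 'a set) \<times>
                    (nat \<Rightarrow> nat \<Rightarrow> nat \<Rightarrow> (nat \<Rightarrow> 'a set) set)) graded_module" where
  "D \<equiv> decomposition_module R \<mm> (PIdl a) a"

lemmas decomposition_defs = decomposition_module_def gm_pair_def gm_sum_def gm_power_def gm_shift_def

lemma class_smult:
  assumes "x \<in> P i"
  shows "cls i x \<odot>\<^bsub>fiber_module R \<mm> (PIdl a)\<^esub> f = cls i x \<otimes>\<^bsub>F\<^esub> f"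
  using fiber_map_class[OF fiber_axioms fiber_axioms subset_refl assms] by (simp add: fiber_module_def)

text \<open>All index sets are finite, so the finite-support conditions in \<open>gm_sum\<close>
  hold automatically and nested extensional products remain.\<close>

lemma hcomp_decomposition:
  "v \<in> hcomp (D r \<alpha> \<beta>) k \<longleftrightarrow>
    fst v \<in> (\<Pi>\<^sub>E i\<in>{0..r}. \<Pi>\<^sub>E c\<in>{..<\<alpha> i}. hcomp (gm_shift i (fiber_module R \<mm> (PIdl a))) k) \<and>
    snd v \<in> (\<Pi>\<^sub>E i\<in>{1..r - 1}. \<Pi>\<^sub>E j\<in>{1..r - i}. \<Pi>\<^sub>E c\<in>{..<\<beta> i j}. hcomp (gm_shift i (tor j)) k)"
  by (simp add: decomposition_module_def gm_pair_def gm_sum_def gm_power_def mem_Times_iff)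

text \<open>For k < i the subtraction k - i gives 0, which would suggest a component of degree 0,
  while the shifted module is zero there. The clause forcing d into \<open>\<mm>\<close> records
  this, so one form of representative serves both cases.\<close>

lemma decomposition_free_component:
  assumes "v \<in> hcomp (D r \<alpha> \<beta>) k" "i \<in> {0..r}" "c < \<alpha> i"
  shows "\<exists>d\<in>carrier R. fst v i c = cls (k - i) (d \<otimes> a [^] (k - i)) \<and> (k < i \<longrightarrow> d \<in> \<mm>)"
proof -
  have v: "fst v i c \<in> hcomp (gm_shift i (fiber_module R \<mm> (PIdl a))) k"
    using assms(1,3) PiE_mem[OF _ assms(2)] PiE_mem unfolding hcomp_decomposition
    by (metis (no_types, lifting) lessThan_iff)
  show ?thesis
  proof (cases "i \<le> k")
    case True
    thus ?thesis using v hcomp_fiber[of "k - i"] by (auto simp: gm_shift_def)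
  next
    case False
    hence "fst v i c = \<zero>\<^bsub>F\<^esub>" using v by (simp add: gm_shift_def fiber_module_def)
    thus ?thesis
      using zero_cone_eq_class[of "k - i"] a_pow_closed[of "k - i"]
        additive_subgroup.zero_closed[OF ideal.axioms(1)[OF m_ideal]]
      by (intro bexI[of _ \<zero>]) auto
  qed
qed

text \<open>As in the free case, d in \<open>\<mm>\<close> marks the degrees below the shift, where
  k - i is cut off at 0.\<close>

lemma decomposition_torsion_component:
  assumes "v \<in> hcomp (D r \<alpha> \<beta>) k" "i \<in> {1..r - 1}" "j \<in> {1..r - i}" "c < \<beta> i j"
  shows "\<exists>d\<in>carrier R. snd v i j c = tcls j (k - i) d \<and> (k < i \<longrightarrow> d \<in> \<mm>)"
proof -
  have v: "snd v i j c \<in> hcomp (gm_shift i (tor j)) k"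
    using assms(1,4) PiE_mem[OF _ assms(2)] PiE_mem[OF _ assms(3)] PiE_mem unfolding hcomp_decomposition
    by (metis (no_types, lifting) lessThan_iff)
  show ?thesis
  proof (cases "i \<le> k")
    case True
    thus ?thesis using v hcomp_tor[of j "k - i"] by (auto simp: gm_shift_def)
  next
    case False
    hence "snd v i j c = T j" using v by (simp add: gm_shift_def tor_simps(1))
    thus ?thesis
      using tcls_zero[of j "k - i"] additive_subgroup.zero_closed[OF ideal.axioms(1)[OF m_ideal]]
      by (intro bexI[of _ \<zero>]) auto
  qed
qed

lemma decomposition_zero_iff:
  assumes "v \<in> hcomp (D r \<alpha> \<beta>) k"
  shows "v = \<zero>\<^bsub>D r \<alpha> \<beta>\<^esub> \<longleftrightarrow>
    (\<forall>i\<in>{0..r}. \<forall>c<\<alpha> i. fst v i c = \<zero>\<^bsub>F\<^esub>) \<and>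
    (\<forall>i\<in>{1..r - 1}. \<forall>j\<in>{1..r - i}. \<forall>c<\<beta> i j. snd v i j c = T j)" (is "?L \<longleftrightarrow> ?R")
proof
  assume ?L
  thus ?R by (simp add: decomposition_defs fiber_module_def tor_simps)
next
  assume zero: ?R
  have v1: "fst v \<in> (\<Pi>\<^sub>E i\<in>{0..r}. \<Pi>\<^sub>E c\<in>{..<\<alpha> i}. hcomp (gm_shift i (fiber_module R \<mm> (PIdl a))) k)"
    and v2: "snd v \<in> (\<Pi>\<^sub>E i\<in>{1..r - 1}. \<Pi>\<^sub>E j\<in>{1..r - i}. \<Pi>\<^sub>E c\<in>{..<\<beta> i j}. hcomp (gm_shift i (tor j)) k)"
    using assms unfolding hcomp_decomposition by simp_all
  have "fst v = (\<lambda>i\<in>{0..r}. \<lambda>c\<in>{..<\<alpha> i}. \<zero>\<^bsub>F\<^esub>)"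
  proof (rule PiE_eq_restrict[OF v1])
    fix i assume i: "i \<in> {0..r}"
    show "fst v i = (\<lambda>c\<in>{..<\<alpha> i}. \<zero>\<^bsub>F\<^esub>)"
      using i zero by (intro PiE_eq_restrict[OF PiE_mem[OF v1 i]]) simp
  qed
  moreover have "snd v = (\<lambda>i\<in>{1..r - 1}. \<lambda>j\<in>{1..r - i}. \<lambda>c\<in>{..<\<beta> i j}. T j)"
  proof (rule PiE_eq_restrict[OF v2], rule PiE_eq_restrict[OF PiE_mem[OF v2]])
    fix i j assume i: "i \<in> {1..r - 1}" and j: "j \<in> {1..r - i}"
    show "snd v i j = (\<lambda>c\<in>{..<\<beta> i j}. T j)"
      using i j zero by (intro PiE_eq_restrict[OF PiE_mem[OF PiE_mem[OF v2 i] j]]) simp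
  qed
  ultimately have "fst v = fst \<zero>\<^bsub>D r \<alpha> \<beta>\<^esub>" "snd v = snd \<zero>\<^bsub>D r \<alpha> \<beta>\<^esub>"
    by (simp_all add: decomposition_defs fiber_module_def tor_simps(1))
  thus ?L by (rule prod_eqI)
qed

lemma decomposition_smult_zero_iff:
  "s \<odot>\<^bsub>D r \<alpha> \<beta>\<^esub> v = \<zero>\<^bsub>D r \<alpha> \<beta>\<^esub> \<longleftrightarrow>
    (\<forall>i\<in>{0..r}. \<forall>c<\<alpha> i. s \<odot>\<^bsub>fiber_module R \<mm> (PIdl a)\<^esub> fst v i c = \<zero>\<^bsub>F\<^esub>) \<and>
    (\<forall>i\<in>{1..r - 1}. \<forall>j\<in>{1..r - i}. \<forall>c<\<beta> i j. s \<odot>\<^bsub>tor j\<^esub> snd v i j c = T j)" (is "?L \<longleftrightarrow> ?R")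
proof
  assume eq: ?L
  show ?R
  proof (intro conjI ballI allI impI)
    fix i c assume "i \<in> {0..r}" "c < \<alpha> i"
    thus "s \<odot>\<^bsub>fiber_module R \<mm> (PIdl a)\<^esub> fst v i c = \<zero>\<^bsub>F\<^esub>"
      using arg_cong[OF eq, of "\<lambda>v. fst v i c"] by (simp add: decomposition_defs fiber_module_def)
  next
    fix i j c assume "i \<in> {1..r - 1}" "j \<in> {1..r - i}" "c < \<beta> i j"
    thus "s \<odot>\<^bsub>tor j\<^esub> snd v i j c = T j"
      using arg_cong[OF eq, of "\<lambda>v. snd v i j c"] by (simp add: decomposition_defs tor_simps(1))
  qed
next
  assume ?R
  thus ?L by (auto simp: decomposition_defs fiber_module_def tor_simps(1) restrict_def fun_eq_iff)
qed

lemma decomposition_add_torsion: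
  assumes "i \<in> {1..r - 1}" "j \<in> {1..r - i}" "c < \<beta> i j"
  shows "snd (v \<oplus>\<^bsub>D r \<alpha> \<beta>\<^esub> w) i j c = snd v i j c \<oplus>\<^bsub>tor j\<^esub> snd w i j c"
  using assms by (simp add: decomposition_defs)

lemma decomposition_smult_torsion:
  assumes "i \<in> {1..r - 1}" "j \<in> {1..r - i}" "c < \<beta> i j"
  shows "snd (s \<odot>\<^bsub>D r \<alpha> \<beta>\<^esub> v) i j c = s \<odot>\<^bsub>tor j\<^esub> snd v i j c"
  using assms by (simp add: decomposition_defs)

text \<open>Multiplication by a^l keeps the coefficient d and raises the degree by l. On a free
  summand d in \<open>\<mm>\<close> remains the only way to vanish; on a torsion summand the new
  degree k - i + l may also reach j. The guard i \<le> k excludes the cut-off subtraction, where the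
  component is zero anyway.\<close>

lemma decomposition_kernel_iff:
  assumes v: "v \<in> hcomp (D r \<alpha> \<beta>) k"
  shows "cls l (a [^] l) \<odot>\<^bsub>D r \<alpha> \<beta>\<^esub> v = \<zero>\<^bsub>D r \<alpha> \<beta>\<^esub> \<longleftrightarrow>
    (\<forall>i\<in>{0..r}. \<forall>c<\<alpha> i. fst v i c = \<zero>\<^bsub>F\<^esub>) \<and>
    (\<forall>i\<in>{1..r - 1}. \<forall>j\<in>{1..r - i}. \<forall>c<\<beta> i j. snd v i j c = T j \<or> i \<le> k \<and> j \<le> k - i + l)"
proof -
  \<comment> \<open>Brings the scalar into the form \<open>d \<otimes> a [^] i\<close> for which the
    multiplication rules are stated, with coefficient 1.\<close>
  have cls_l: "cls l (a [^] l) = cls l (\<one> \<otimes> a [^] l)" by (simp add: a_pow_closed)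
  have free: "cls l (a [^] l) \<odot>\<^bsub>fiber_module R \<mm> (PIdl a)\<^esub> fst v i c = \<zero>\<^bsub>F\<^esub> \<longleftrightarrow> fst v i c = \<zero>\<^bsub>F\<^esub>"
    if "i \<in> {0..r}" "c < \<alpha> i" for i c
  proof -
    have "\<exists>d\<in>carrier R. fst v i c = cls (k - i) (d \<otimes> a [^] (k - i)) \<and> (k < i \<longrightarrow> d \<in> \<mm>)"
      using decomposition_free_component[OF v that] .
    then obtain d where d: "d \<in> carrier R" "fst v i c = cls (k - i) (d \<otimes> a [^] (k - i))" by blast
    show ?thesis
      unfolding class_smult[OF a_pow_in_P] unfolding cls_l d(2)
        class_multiple_mult[OF d(1) one_closed] class_multiple_eq_zero_iff[OF d(1)]
        class_multiple_eq_zero_iff[OF m_closed[OF one_closed d(1)]]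
      using d(1) by simp
  qed
  have torsion: "cls l (a [^] l) \<odot>\<^bsub>tor j\<^esub> snd v i j c = T j \<longleftrightarrow>
      snd v i j c = T j \<or> i \<le> k \<and> j \<le> k - i + l"
    if "i \<in> {1..r - 1}" "j \<in> {1..r - i}" "c < \<beta> i j" for i j c
  proof -
    have "\<exists>d\<in>carrier R. snd v i j c = tcls j (k - i) d \<and> (k < i \<longrightarrow> d \<in> \<mm>)"
      using decomposition_torsion_component[OF v that] .
    then obtain d where d: "d \<in> carrier R" "snd v i j c = tcls j (k - i) d" "k < i \<longrightarrow> d \<in> \<mm>" by blast
    have smult: "cls l (a [^] l) \<odot>\<^bsub>tor j\<^esub> snd v i j c = T j \<longleftrightarrow> d \<in> \<mm> \<or> j \<le> l + (k - i)"
      unfolding cls_l d(2) tcls_smult[OF d(1) one_closed]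
        tcls_eq_zero_iff[OF m_closed[OF one_closed d(1)]] using d(1) by simp
    have zero: "snd v i j c = T j \<longleftrightarrow> d \<in> \<mm> \<or> j \<le> k - i"
      unfolding d(2) by (rule tcls_eq_zero_iff[OF d(1)])
    show ?thesis
      unfolding smult zero using d(3) by (cases "d \<in> \<mm>"; cases "i \<le> k") auto
  qed
  show ?thesis
    unfolding decomposition_smult_zero_iff
    by (rule arg_cong2[where f = "(\<and>)"];
        (rule ball_cong[OF refl])+, rule all_cong1, rule imp_cong[OF refl], erule free torsion, assumption+)
qed

end

section \<open>Colon ideals and generators of principal reductions\<close>

lemma (in cring) ideal_colon_elt:
  assumes "ideal L R" "y \<in> carrier R"
  shows "ideal (colon_elt R L y) R"
proof (rule idealI[OF ring_axioms])
  interpret L: ideal L R by fact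
  show "subgroup (colon_elt R L y) (add_monoid R)"
  proof (rule group.subgroupI[OF a_group])
    show "colon_elt R L y \<subseteq> carrier (add_monoid R)" by (auto simp: colon_elt_def)
    have "\<zero> \<in> colon_elt R L y" using assms(2) L.zero_closed by (simp add: colon_elt_def)
    thus "colon_elt R L y \<noteq> {}" by blast
    fix u v assume u: "u \<in> colon_elt R L y" and v: "v \<in> colon_elt R L y"
    show "u \<otimes>\<^bsub>add_monoid R\<^esub> v \<in> colon_elt R L y"
      using u v assms(2) L.a_closed by (simp add: colon_elt_def l_distr)
    have "\<ominus> u \<in> colon_elt R L y"
      using u assms(2) L.a_inv_closed by (simp add: colon_elt_def l_minus)
    thus "inv\<^bsub>add_monoid R\<^esub> u \<in> colon_elt R L y" by (simp add: a_inv_def)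
  qed
  fix u x assume u: "u \<in> colon_elt R L y" and x: "x \<in> carrier R"
  hence "(x \<otimes> u) \<otimes> y = x \<otimes> (u \<otimes> y)" using assms(2) by (simp add: colon_elt_def m_assoc)
  thus xu: "x \<otimes> u \<in> colon_elt R L y"
    using u x L.I_l_closed by (simp add: colon_elt_def)
  moreover have "x \<otimes> u = u \<otimes> x" using u x by (simp add: colon_elt_def m_comm)
  ultimately show "u \<otimes> x \<in> colon_elt R L y" by simp
qed

text \<open>The reduction equation I^(n+1) = (a) I^n puts x^(n+1) into (a). So az = 0 implies
  x^(n+1) z = 0, and cancelling x repeatedly gives z = 0.\<close>

lemma (in cring) nonzerodivisor_reduction:
  assumes I: "ideal I R" and x: "x \<in> I" "nonzerodivisor R x"
    and a: "a \<in> carrier R" and red: "reduction R (PIdl a) I"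
  shows "nonzerodivisor R a"
proof -
  \<comment> \<open>I fills both slots of the locale; the aim is to have the facts about its powers
    \<open>P\<close>.\<close>
  interpret fiber R I I by (intro fiber.intro fiber_axioms.intro cring_axioms I)
  have xc: "x \<in> carrier R" using x(2) by (simp add: nonzerodivisor_def)
  obtain n where "P (Suc n) = ideal_prod R (PIdl a) (P n)"
    using red unfolding reduction_def by blast
  hence "P (Suc n) \<subseteq> PIdl a"
    using ideal_prod_inter[OF cgenideal_ideal[OF a] P_ideal[of n]] by blast
  moreover have x_pow: "x [^] m \<in> P m" for m :: nat
    by (induction m) (simp_all add: ideals_set_def ideal_prod.prod x(1))
  ultimately have "x [^] Suc n \<in> PIdl a" by blast
  then obtain y where y: "y \<in> carrier R" "x [^] Suc n = y \<otimes> a"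
    unfolding cgenideal_def by blast
  have cancel: "z = \<zero>" if "z \<in> carrier R" "x [^] m \<otimes> z = \<zero>" for z and m :: nat
    using that
  proof (induction m arbitrary: z)
    case (Suc m)
    have "x [^] m \<otimes> (x \<otimes> z) = \<zero>" using Suc.prems xc by (simp add: m_assoc)
    hence "x \<otimes> z = \<zero>" by (rule Suc.IH[OF m_closed[OF xc Suc.prems(1)]])
    thus ?case using x(2) Suc.prems(1) by (simp add: nonzerodivisor_def)
  qed simp
  have "z = \<zero>" if z: "z \<in> carrier R" "a \<otimes> z = \<zero>" for z
  proof (rule cancel[OF z(1)])
    show "x [^] Suc n \<otimes> z = \<zero>"
      unfolding y(2) using m_assoc[OF y(1) a z(1)] z(2) y(1) by simp
  qed
  thus ?thesis using a by (simp add: nonzerodivisor_def)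
qed

section \<open>Counting the kernel of multiplication by a^l\<close>

context principal_fiber
begin

text \<open>\<open>gm_iso\<close> does not postulate that zero goes to zero; this lemma supplies it.
  The scalar zero is written as 0 times a^0 so that the rules for multiples of powers apply.\<close>

lemma decomposition_zero_smult:
  assumes v: "v \<in> hcomp (D r \<alpha> \<beta>) k"
  shows "cls 0 (\<zero> \<otimes> a [^] (0::nat)) \<odot>\<^bsub>D r \<alpha> \<beta>\<^esub> v = \<zero>\<^bsub>D r \<alpha> \<beta>\<^esub>"
  unfolding decomposition_smult_zero_iff
proof (intro conjI ballI allI impI)
  have zm: "\<zero> \<in> \<mm>" by (rule additive_subgroup.zero_closed[OF ideal.axioms(1)[OF m_ideal]])
  {
    fix i c assume "i \<in> {0..r}" "c < \<alpha> i"
    then obtain d where d: "d \<in> carrier R" "fst v i c = cls (k - i) (d \<otimes> a [^] (k - i))"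
      using decomposition_free_component[OF v] by blast
    show "cls 0 (\<zero> \<otimes> a [^] (0::nat)) \<odot>\<^bsub>fiber_module R \<mm> (PIdl a)\<^esub> fst v i c = \<zero>\<^bsub>F\<^esub>"
      unfolding class_smult[OF multiple_in_P[OF zero_closed]] d(2)
        class_multiple_mult[OF d(1) zero_closed] class_multiple_eq_zero_iff[OF m_closed[OF zero_closed d(1)]]
      using d(1) zm by simp
  }
  fix i j c assume "i \<in> {1..r - 1}" "j \<in> {1..r - i}" "c < \<beta> i j"
  then obtain d where d: "d \<in> carrier R" "snd v i j c = tcls j (k - i) d"
    using decomposition_torsion_component[OF v] by blast
  show "cls 0 (\<zero> \<otimes> a [^] (0::nat)) \<odot>\<^bsub>tor j\<^esub> snd v i j c = T j"
    unfolding d(2) tcls_smult[OF d(1) zero_closed] tcls_eq_zero_iff[OF m_closed[OF zero_closed d(1)]]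
    using d(1) zm by simp
qed

text \<open>In degree k the isomorphism identifies I^k/\<open>\<mm>\<close> I^k with the degree k
  part of the decomposition, and the subquotient to be measured with the kernel of a^l there. That
  kernel has one coordinate for each copy of a torsion summand indexed by \<open>\<Lambda>\<close>,
  and \<open>module_length_coordinates\<close> counts these copies.\<close>

lemma f_length_decomposition:
  assumes max: "maximalideal \<mm> R" and I: "ideal I R" and aI: "PIdl a \<subseteq> I"
    and iso: "gm_iso F (fiber_module R \<mm> I) (D r \<alpha> \<beta>)"
    and k: "k \<le> r - 1" and l: "l \<le> r - k"
  shows "f_length R \<mm> I a k l =
    enat (\<Sum>(i, j) \<in> {(i, j). 1 \<le> i \<and> i \<le> k \<and> k - i + 1 \<le> j \<and> j \<le> k - i + l}. \<beta> i j)"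
proof -
  interpret C: fiber R \<mm> I by (intro fiber.intro fiber_axioms.intro cring_axioms m_ideal I)
  interpret m: maximalideal \<mm> R by (fact max)
  obtain \<phi> where bij: "bij_betw \<phi> (carrier C.F) (carrier (D r \<alpha> \<beta>))"
    and \<phi>_add: "\<And>f g. f \<in> carrier C.F \<Longrightarrow> g \<in> carrier C.F \<Longrightarrow> \<phi> (f \<oplus>\<^bsub>C.F\<^esub> g) = \<phi> f \<oplus>\<^bsub>D r \<alpha> \<beta>\<^esub> \<phi> g"
    and \<phi>_smult: "\<And>s f. s \<in> carrier F \<Longrightarrow> f \<in> carrier C.F \<Longrightarrow>
        \<phi> (fiber_map R \<mm> I s \<otimes>\<^bsub>C.F\<^esub> f) = s \<odot>\<^bsub>D r \<alpha> \<beta>\<^esub> \<phi> f"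
    and \<phi>_hcomp: "\<And>n. \<phi> ` hcomp (fiber_module R \<mm> I) n = hcomp (D r \<alpha> \<beta>) n"
  proof -
    have "carrier (fiber_module R \<mm> I) = carrier C.F"
      "add (fiber_module R \<mm> I) = add C.F"
      "smult (fiber_module R \<mm> I) = (\<lambda>s f. fiber_map R \<mm> I s \<otimes>\<^bsub>C.F\<^esub> f)"
      by (simp_all add: fiber_module_def)
    thus thesis using iso that unfolding gm_iso_def by auto
  qed
  have P_sub: "x \<in> C.P n" if "x \<in> P n" for x n
    using that ideal_pow_mono[OF aI] by blast
  have \<phi>_class_smult: "cls i y \<odot>\<^bsub>D r \<alpha> \<beta>\<^esub> \<phi> (C.cls n x) = \<phi> (C.cls (i + n) (y \<otimes> x))"
    if y: "y \<in> P i" and x: "x \<in> C.P n" for i n y x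
  proof -
    have "fiber_map R \<mm> I (cls i y) = C.cls i y"
      by (rule fiber_map_class[OF fiber_axioms C.fiber_axioms aI y])
    thus ?thesis
      using \<phi>_smult[OF class_closed[OF y] C.class_closed[OF x]] C.class_mult_class[OF P_sub[OF y] x] by simp
  qed
  \<comment> \<open>Via the scalar zero, so that no group structure on the decomposition module is needed.\<close>
  have \<phi>_zero: "\<phi> \<zero>\<^bsub>C.F\<^esub> = \<zero>\<^bsub>D r \<alpha> \<beta>\<^esub>"
  proof -
    have "\<phi> \<zero>\<^bsub>C.F\<^esub> = \<phi> (C.cls 0 \<zero>)" by (simp only: C.zero_cone_eq_class[of 0])
    also have "\<dots> = \<phi> (C.cls (0 + 0) ((\<zero> \<otimes> a [^] (0::nat)) \<otimes> \<zero>))" by simp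
    also have "\<dots> = cls 0 (\<zero> \<otimes> a [^] (0::nat)) \<odot>\<^bsub>D r \<alpha> \<beta>\<^esub> \<phi> (C.cls 0 \<zero>)"
      by (rule \<phi>_class_smult[OF multiple_in_P[OF zero_closed] C.zero_in_P, symmetric])
    also have "\<dots> = \<zero>\<^bsub>D r \<alpha> \<beta>\<^esub>"
      using \<phi>_hcomp[of 0] C.hcomp_fiber_module[of 0] C.zero_in_P[of 0]
      by (intro decomposition_zero_smult[of _ r \<alpha> \<beta> 0]) blast
    finally show ?thesis .
  qed
  have \<phi>_class_zero: "\<phi> (C.cls n x) = \<zero>\<^bsub>D r \<alpha> \<beta>\<^esub> \<longleftrightarrow> x \<in> C.K n" if x: "x \<in> C.P n" for n x
  proof -
    have "\<phi> (C.cls n x) = \<phi> \<zero>\<^bsub>C.F\<^esub> \<longleftrightarrow> C.cls n x = \<zero>\<^bsub>C.F\<^esub>"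
      using bij C.class_closed[OF x] abelian_monoid.zero_closed[OF abelian_group.axioms(1)[OF C.abelian_group_cone]]
      by (intro inj_on_eq_iff[of \<phi> "carrier C.F"]) (simp_all only: bij_betw_def)
    thus ?thesis unfolding \<phi>_zero C.class_eq_zero_iff[OF x] .
  qed
  \<comment> \<open>On I^k this map has kernel \<open>\<mm>\<close> I^k and image the whole degree k
    part of the decomposition; it is the form in which the isomorphism is used from here on.\<close>
  define \<psi> where "\<psi> x = \<phi> (C.cls k x)" for x
  have \<psi>_hcomp: "\<psi> x \<in> hcomp (D r \<alpha> \<beta>) k" if "x \<in> C.P k" for x
    using \<phi>_hcomp[of k] C.hcomp_fiber_module[of k] that unfolding \<psi>_def by blast
  have \<psi>_surj: "\<exists>x\<in>C.P k. \<psi> x = v" if "v \<in> hcomp (D r \<alpha> \<beta>) k" for v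
    using that unfolding \<psi>_def \<phi>_hcomp[of k, symmetric] C.hcomp_fiber_module[of k] by blast
  define L where "L = C.P k \<inter> colon_elt R (C.K (k + l)) (a [^] l)"
  have L_iff: "x \<in> L \<longleftrightarrow> x \<in> C.P k \<and> cls l (a [^] l) \<odot>\<^bsub>D r \<alpha> \<beta>\<^esub> \<psi> x = \<zero>\<^bsub>D r \<alpha> \<beta>\<^esub>" for x
  proof (cases "x \<in> C.P k")
    case True
    have "cls l (a [^] l) \<odot>\<^bsub>D r \<alpha> \<beta>\<^esub> \<psi> x = \<zero>\<^bsub>D r \<alpha> \<beta>\<^esub> \<longleftrightarrow> a [^] l \<otimes> x \<in> C.K (l + k)"
      unfolding \<psi>_def \<phi>_class_smult[OF a_pow_in_P True]
      by (rule \<phi>_class_zero[OF C.P_mult_closed[OF P_sub[OF a_pow_in_P] True]])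
    moreover have "a [^] l \<otimes> x = x \<otimes> a [^] l" by (rule m_comm[OF a_pow_closed C.P_carrier[OF True]])
    moreover have "l + k = k + l" by simp
    ultimately show ?thesis
      using True C.P_carrier[OF True] by (simp only: L_def colon_elt_def) blast
  qed (simp add: L_def)
  have L_ideal: "ideal L R"
    unfolding L_def by (intro i_intersect C.P_ideal ideal_colon_elt C.K_ideal a_pow_closed)
  have K_sub: "C.K k \<subseteq> L"
    using C.K_subset_P[of k] C.K_mult_closed(1)[OF _ P_sub[OF a_pow_in_P]] C.P_carrier[of _ k]
    by (auto simp: L_def colon_elt_def)
  have LP: "x \<in> C.P k" if "x \<in> L" for x using that by (simp add: L_def)
  define \<Lambda> where "\<Lambda> = {(i, j). 1 \<le> i \<and> i \<le> k \<and> k - i + 1 \<le> j \<and> j \<le> k - i + l}"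
  define X where "X = (SIGMA (i, j):\<Lambda>. {..<\<beta> i j})"
  have "finite \<Lambda>"
    by (rule finite_subset[of _ "{1..k} \<times> {..k + l}"]) (auto simp: \<Lambda>_def)
  hence card_X: "card X = (\<Sum>(i, j) \<in> \<Lambda>. \<beta> i j)" and "finite X"
    by (auto simp: X_def card_SigmaI split_beta)
  \<comment> \<open>An arbitrary enumeration of the summand copies, as coordinates must be numbered
    below their count; any order will do.\<close>
  then obtain e where e: "bij_betw e {..<card X} X"
    using ex_bij_betw_nat_finite[of X] by (auto simp: lessThan_atLeast0)
  \<comment> \<open>The bounds on k and l ensure that every index of \<open>\<Lambda>\<close> occurs
    in the decomposition: i \<le> k \<le> r - 1 and j \<le> k - i + l \<le> r - i.\<close>
  have range: "i \<in> {1..r - 1}" "j \<in> {1..r - i}" "i \<le> k" "k - i < j" "j \<le> k - i + l" "c < \<beta> i j"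
    if "((i, j), c) \<in> X" for i j c
    using that k l by (auto simp: X_def \<Lambda>_def)
  \<comment> \<open>A choice of coefficient for one torsion component. It is determined only modulo
    \<open>\<mm>\<close>, so its linearity below is an equality of cosets.\<close>
  define q :: "(nat \<times> nat) \<times> nat \<Rightarrow>
      (nat \<Rightarrow> nat \<Rightarrow> nat \<Rightarrow> 'a set) \<times> (nat \<Rightarrow> nat \<Rightarrow> nat \<Rightarrow> (nat \<Rightarrow> 'a set) set) \<Rightarrow> 'a"
    where "q = (\<lambda>((i, j), c) v. SOME d. d \<in> carrier R \<and> snd v i j c = tcls j (k - i) d)"
  have q: "q ((i, j), c) v \<in> carrier R" "snd v i j c = tcls j (k - i) (q ((i, j), c) v)"
    if t: "((i, j), c) \<in> X" and v: "v \<in> hcomp (D r \<alpha> \<beta>) k" for i j c v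
  proof -
    have "\<exists>d. d \<in> carrier R \<and> snd v i j c = tcls j (k - i) d"
      using decomposition_torsion_component[OF v range(1,2,6)[OF t]] by blast
    from someI_ex[OF this] show "q ((i, j), c) v \<in> carrier R" "snd v i j c = tcls j (k - i) (q ((i, j), c) v)"
      by (simp_all add: q_def)
  qed
  \<comment> \<open>The lower bound k - i < j in \<open>\<Lambda>\<close> enters here: degree k - i
    is not yet truncated, so the coefficient is well defined modulo \<open>\<mm>\<close>.\<close>
  have cong: "\<mm> +> c = \<mm> +> d" if "tcls j n c = tcls j n d" "n < j" "c \<in> carrier R" "d \<in> carrier R" for j n c d
    using that tcls_eq_iff quotient_eq_iff_same_a_r_cos[OF m_ideal] by (metis not_le)
  have q_mem_iff: "q ((i, j), c) v \<in> \<mm> \<longleftrightarrow> snd v i j c = T j"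
    if t: "((i, j), c) \<in> X" and v: "v \<in> hcomp (D r \<alpha> \<beta>) k" for i j c v
    using tcls_eq_zero_iff[OF q(1)[OF t v], of j "k - i"] q(2)[OF t v] range(4)[OF t] by (metis not_le)
  have x_K_iff: "x \<in> C.K k \<longleftrightarrow> (\<forall>t\<in>X. q t (\<psi> x) \<in> \<mm>)" if x: "x \<in> L" for x
  proof -
    note v = \<psi>_hcomp[OF LP[OF x]]
    have "x \<in> C.K k \<longleftrightarrow> \<psi> x = \<zero>\<^bsub>D r \<alpha> \<beta>\<^esub>"
      unfolding \<psi>_def by (rule \<phi>_class_zero[OF LP[OF x], symmetric])
    also have "\<dots> \<longleftrightarrow> (\<forall>t\<in>X. q t (\<psi> x) \<in> \<mm>)"
    proof
      assume z: "\<psi> x = \<zero>\<^bsub>D r \<alpha> \<beta>\<^esub>"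
      have "snd (\<psi> x) i j c = T j" if t: "((i, j), c) \<in> X" for i j c
        using z range(1,2,6)[OF t] unfolding decomposition_zero_iff[OF v] by blast
      thus "\<forall>t\<in>X. q t (\<psi> x) \<in> \<mm>" using q_mem_iff[OF _ v] by fast
    next
      assume q0: "\<forall>t\<in>X. q t (\<psi> x) \<in> \<mm>"
      have ker: "(\<forall>i\<in>{0..r}. \<forall>c<\<alpha> i. fst (\<psi> x) i c = \<zero>\<^bsub>F\<^esub>) \<and>
        (\<forall>i\<in>{1..r - 1}. \<forall>j\<in>{1..r - i}. \<forall>c<\<beta> i j. snd (\<psi> x) i j c = T j \<or> i \<le> k \<and> j \<le> k - i + l)"
        using x unfolding L_iff decomposition_kernel_iff[OF v] by blast
      \<comment> \<open>Components outside X vanish on their own: the kernel condition kills those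
        with k < i or k - i + l < j, and truncation those with j \<le> k - i. Only X is left for the
        coordinates to test.\<close>
      have "snd (\<psi> x) i j c = T j" if i: "i \<in> {1..r - 1}" and j: "j \<in> {1..r - i}" and c: "c < \<beta> i j" for i j c
      proof (cases "i \<le> k \<and> j \<le> k - i + l")
        case False
        thus ?thesis using ker i j c by blast
      next
        case ij: True
        show ?thesis
        proof (cases "j \<le> k - i")
          case True
          obtain d where "d \<in> carrier R" "snd (\<psi> x) i j c = tcls j (k - i) d"
            using decomposition_torsion_component[OF v i j c] by blast
          thus ?thesis using True tcls_eq_zero_iff by simp
        next
          case False
          hence t: "((i, j), c) \<in> X" using ij i c by (auto simp: X_def \<Lambda>_def)
          thus ?thesis using q0 q_mem_iff[OF t v] by blast
        qed
      qed
      thus "\<psi> x = \<zero>\<^bsub>D r \<alpha> \<beta>\<^esub>" using ker unfolding decomposition_zero_iff[OF v] by blast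
    qed
    finally show ?thesis .
  qed
  have q_add: "\<mm> +> q t (\<psi> (x \<oplus> y)) = \<mm> +> (q t (\<psi> x) \<oplus> q t (\<psi> y))"
    if t': "t \<in> X" and x: "x \<in> L" and y: "y \<in> L" for t x y
  proof -
    obtain i j c where tt: "t = ((i, j), c)" by (metis surj_pair)
    have t: "((i, j), c) \<in> X" using t' tt by simp
    note vx = \<psi>_hcomp[OF LP[OF x]] and vy = \<psi>_hcomp[OF LP[OF y]]
    have xy: "x \<oplus> y \<in> C.P k"
      using additive_subgroup.a_closed[OF ideal.axioms(1)[OF C.P_ideal]] LP x y by blast
    note vxy = \<psi>_hcomp[OF xy]
    have "\<psi> (x \<oplus> y) = \<psi> x \<oplus>\<^bsub>D r \<alpha> \<beta>\<^esub> \<psi> y"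
      unfolding \<psi>_def C.class_add[OF LP[OF x] LP[OF y], symmetric]
      by (intro \<phi>_add C.class_closed LP x y)
    hence "snd (\<psi> (x \<oplus> y)) i j c = snd (\<psi> x) i j c \<oplus>\<^bsub>tor j\<^esub> snd (\<psi> y) i j c"
      using decomposition_add_torsion[where v = "\<psi> x" and w = "\<psi> y" and \<alpha> = \<alpha> and \<beta> = \<beta> and r = r, OF range(1,2,6)[OF t]] by simp
    hence "tcls j (k - i) (q ((i, j), c) (\<psi> (x \<oplus> y)))
        = tcls j (k - i) (q ((i, j), c) (\<psi> x) \<oplus> q ((i, j), c) (\<psi> y))"
      unfolding q(2)[OF t vx] q(2)[OF t vy] q(2)[OF t vxy] tcls_add[OF q(1)[OF t vx] q(1)[OF t vy]] .
    thus ?thesis unfolding tt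
      by (rule cong) (use q(1)[OF t] vx vy vxy range(4)[OF t] in auto)
  qed
  have q_smult: "\<mm> +> q t (\<psi> (b \<otimes> x)) = \<mm> +> (b \<otimes> q t (\<psi> x))"
    if t': "t \<in> X" and b: "b \<in> carrier R" and x: "x \<in> L" for t b x
  proof -
    obtain i j c where tt: "t = ((i, j), c)" by (metis surj_pair)
    have t: "((i, j), c) \<in> X" using t' tt by simp
    note vx = \<psi>_hcomp[OF LP[OF x]]
    have bx: "b \<otimes> x \<in> C.P k" by (rule ideal.I_l_closed[OF C.P_ideal LP[OF x] b])
    note vbx = \<psi>_hcomp[OF bx]
    \<comment> \<open>A scalar of A acts as a degree 0 element of F(J); this turns F(J)-linearity
      into A-linearity.\<close>
    have "cls 0 (b \<otimes> a [^] (0::nat)) \<odot>\<^bsub>D r \<alpha> \<beta>\<^esub> \<psi> x = \<psi> (b \<otimes> x)"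
      unfolding \<psi>_def \<phi>_class_smult[OF multiple_in_P[OF b] LP[OF x]] using b by simp
    hence "snd (\<psi> (b \<otimes> x)) i j c = cls 0 (b \<otimes> a [^] (0::nat)) \<odot>\<^bsub>tor j\<^esub> snd (\<psi> x) i j c"
      using decomposition_smult_torsion[where v = "\<psi> x" and \<alpha> = \<alpha> and \<beta> = \<beta> and r = r, OF range(1,2,6)[OF t]] by metis
    hence "tcls j (k - i) (q ((i, j), c) (\<psi> (b \<otimes> x))) = tcls j (0 + (k - i)) (b \<otimes> q ((i, j), c) (\<psi> x))"
      unfolding q(2)[OF t vx] q(2)[OF t vbx] tcls_smult[OF q(1)[OF t vx] b] .
    hence "tcls j (k - i) (q ((i, j), c) (\<psi> (b \<otimes> x))) = tcls j (k - i) (b \<otimes> q ((i, j), c) (\<psi> x))"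
      by (simp only: add_0)
    thus ?thesis unfolding tt
      by (rule cong) (use q(1)[OF t] vx vbx b range(4)[OF t] in auto)
  qed
  have q_basis: "\<exists>x\<in>L. q t (\<psi> x) \<notin> \<mm> \<and> (\<forall>t'\<in>X. t' \<noteq> t \<longrightarrow> q t' (\<psi> x) \<in> \<mm>)" if t': "t \<in> X" for t
  proof -
    obtain i j c where tt: "t = ((i, j), c)" by (metis surj_pair)
    have t: "((i, j), c) \<in> X" using t' tt by simp
    \<comment> \<open>The unit vector of one summand copy: coefficient 1 in degree k - i, zero
      elsewhere. It is killed by a^l because j \<le> k - i + l, so any preimage of it under
      \<open>\<psi>\<close> lies in L.\<close>
    define v where "v = ((\<lambda>i\<in>{0..r}. \<lambda>c\<in>{..<\<alpha> i}. \<zero>\<^bsub>F\<^esub>),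
      (\<lambda>i'\<in>{1..r - 1}. \<lambda>j'\<in>{1..r - i'}. \<lambda>c'\<in>{..<\<beta> i' j'}.
         if ((i', j'), c') = ((i, j), c) then tcls j (k - i) \<one> else T j'))"
    have T_in: "T j' \<in> hcomp (tor j') n" for j' n
      unfolding hcomp_tor using tcls_zero[of j' n] zero_closed by (metis image_eqI)
    have Z_in: "\<zero>\<^bsub>F\<^esub> \<in> hcomp (fiber_module R \<mm> (PIdl a)) n" for n
      unfolding hcomp_fiber_module using zero_cone_eq_class[of n] zero_in_P[of n] by (metis image_eqI)
    have zero_fm: "\<zero>\<^bsub>fiber_module R \<mm> (PIdl a)\<^esub> = \<zero>\<^bsub>F\<^esub>" by (simp add: fiber_module_def)
    have v: "v \<in> hcomp (D r \<alpha> \<beta>) k"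
      unfolding hcomp_decomposition v_def
      using T_in Z_in range(3)[OF t] hcomp_tor[of j "k - i"] by (auto simp: gm_shift_def zero_fm tor_simps(1))
    have v_snd: "snd v i' j' c' = (if ((i', j'), c') = ((i, j), c) then tcls j (k - i) \<one> else T j')"
      if "i' \<in> {1..r - 1}" "j' \<in> {1..r - i'}" "c' < \<beta> i' j'" for i' j' c'
      using that by (simp add: v_def)
    have "cls l (a [^] l) \<odot>\<^bsub>D r \<alpha> \<beta>\<^esub> v = \<zero>\<^bsub>D r \<alpha> \<beta>\<^esub>"
      unfolding decomposition_kernel_iff[OF v] using v_snd range(3,5)[OF t] by (auto simp: v_def)
    moreover obtain x where x: "x \<in> C.P k" "\<psi> x = v" using \<psi>_surj[OF v] by blast
    ultimately have "x \<in> L" unfolding L_iff by simp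
    moreover have "q t v \<notin> \<mm>"
    proof -
      \<comment> \<open>The marked component is nonzero because k - i < j and 1 is not in
        \<open>\<mm>\<close>.\<close>
      have "snd v i j c = tcls j (k - i) \<one>" using v_snd[OF range(1,2,6)[OF t]] by simp
      moreover have "\<one> \<notin> \<mm>" using m.one_imp_carrier m.I_notcarr by metis
      ultimately show ?thesis
        unfolding tt q_mem_iff[OF t v] using tcls_eq_zero_iff[OF one_closed, of j "k - i"] range(4)[OF t] by simp
    qed
    moreover have "q t' v \<in> \<mm>" if "t' \<in> X" "t' \<noteq> t" for t'
    proof -
      obtain i' j' c' where tt': "t' = ((i', j'), c')" by (metis surj_pair)
      have s: "((i', j'), c') \<in> X" using that tt' by simp
      have ne: "((i', j'), c') \<noteq> ((i, j), c)" using that(2) unfolding tt tt' .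
      show ?thesis
        unfolding tt' q_mem_iff[OF s v] v_snd[OF range(1,2,6)[OF s]] by (simp only: ne if_False)
    qed
    ultimately show ?thesis using x(2) by blast
  qed
  have eX: "e s \<in> X" if "s < card X" for s
    using that bij_betwE[OF e] by blast
  have ball_X: "(\<forall>t\<in>X. Q t) \<longleftrightarrow> (\<forall>s<card X. Q (e s))" for Q
  proof -
    have "(\<forall>t\<in>e ` {..<card X}. Q t) \<longleftrightarrow> (\<forall>s<card X. Q (e s))" by auto
    thus ?thesis unfolding bij_betw_imp_surj_on[OF e] .
  qed
  have "module_length R (ideal_quot R L (C.K k)) = enat (card X)"
  proof (rule module_length_coordinates[OF max C.K_ideal L_ideal K_sub, where p = "\<lambda>s x. q (e s) (\<psi> x)"])
    show "q (e s) (\<psi> x) \<in> carrier R" if "s < card X" "x \<in> L" for s x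
      using q(1) eX[OF that(1)] \<psi>_hcomp[OF LP[OF that(2)]] by (metis surj_pair)
    show "x \<in> C.K k \<longleftrightarrow> (\<forall>s<card X. q (e s) (\<psi> x) \<in> \<mm>)" if "x \<in> L" for x
      unfolding x_K_iff[OF that] by (rule ball_X)
    show "\<exists>x\<in>L. q (e s) (\<psi> x) \<notin> \<mm> \<and> (\<forall>t<card X. t \<noteq> s \<longrightarrow> q (e t) (\<psi> x) \<in> \<mm>)" if s: "s < card X" for s
    proof -
      obtain x where x: "x \<in> L" "q (e s) (\<psi> x) \<notin> \<mm>" "\<forall>t'\<in>X. t' \<noteq> e s \<longrightarrow> q t' (\<psi> x) \<in> \<mm>"
        using q_basis[OF eX[OF s]] by blast
      have "q (e t) (\<psi> x) \<in> \<mm>" if "t < card X" "t \<noteq> s" for t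
        using x(3) eX[OF that(1)] bij_betw_imp_inj_on[OF e] that s by (metis inj_onD lessThan_iff)
      thus ?thesis using x by blast
    qed
  qed (use q_add q_smult eX in blast)+
  thus ?thesis
    unfolding f_length_def L_def[symmetric] card_X \<Lambda>_def .
qed

end

theorem proposition2p3:
  fixes A :: "('a, 'b) ring_scheme" and \<mm> I J :: "'a set" and a :: 'a
    and r k l :: nat and \<alpha> :: "nat \<Rightarrow> nat" and \<beta> :: "nat \<Rightarrow> nat \<Rightarrow> nat"
  assumes "noetherian_ring A" and "local_ring A \<mm>"
    and "infinite (carrier (A Quot \<mm>))"
    and "regular_ideal A I"
    and "analytic_spread A \<mm> I = 1"
    and "r = reduction_number A I"
    and "a \<in> carrier A" and "J = PIdl\<^bsub>A\<^esub> a" and "minimal_reduction A J I"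
    and "gm_iso (fiber_cone A \<mm> J) (fiber_module A \<mm> I) (decomposition_module A \<mm> J a r \<alpha> \<beta>)"
    and "1 \<le> k" and "k \<le> r - 1" and "1 \<le> l" and "l \<le> r - k"
  shows "f_length A \<mm> I a k l =
    enat (\<Sum>(i, j) \<in> {(i, j). 1 \<le> i \<and> i \<le> k \<and> k - i + 1 \<le> j \<and> j \<le> k - i + l}. \<beta> i j)"
proof -
  interpret cring A using assms(2) by (simp add: local_ring_def)
  have max: "maximalideal \<mm> A" using assms(2) by (simp add: local_ring_def)
  have I: "ideal I A" using assms(4) by (simp add: regular_ideal_def)
  have red: "reduction A (PIdl\<^bsub>A\<^esub> a) I"
    using assms(8,9) by (simp add: minimal_reduction_def)
  \<comment> \<open>Regularity of I enters here: the non-zero-divisor it contains forces a to be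
    one, through the reduction equation.\<close>
  have nzd: "nonzerodivisor A a"
    using assms(4) nonzerodivisor_reduction[OF I _ _ assms(7) red] by (auto simp: regular_ideal_def)
  interpret principal_fiber A \<mm> a
    by (intro principal_fiber.intro principal_fiber_axioms.intro cring_axioms nzd maximalideal.axioms(1)[OF max])
  show ?thesis
    using f_length_decomposition[OF max I _ _ assms(12,14)] assms(8,10) red
    by (simp add: reduction_def)
qed

end
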